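(* Let $\Gamma$ be a totally ordered abelian group. Then its small-extensions closure $\Gamma_{\mathrm{sme}}$ is a complete totally ordered set; that is, every non-empty subset $X\subset\Gamma_{\mathrm{sme}}$ admits a supremum (a minimal upper bound) in $\Gamma_{\mathrm{sme}}$.
   Context: Ordered sets are totally ordered; ordered groups are totally ordered abelian groups; embeddings strictly preserve order. Setting. $\Gamma_{\mathbb Q}=\Gamma\otimes_{\mathbb Z}\mathbb Q$ is the divisible hull with its natural order. A subgroup $H$ of an ordered group is convex if $|\rho|\le|\gamma|$, $\gamma\in H$ imply $\rho\in H$; it is principal if it is the convex subgroup generated by one element. $I=\mathrm{Prin}(\Gamma)=\mathrm{Prin}(\Gamma_{\mathbb Q})$ is the set of non-zero principal convex subgroups (canonically the same for $\Gamma$ and $\Gamma_{\mathbb Q}$), ordered by decreasing inclusion. For $i\in I$, $H_i\subset\Gamma_{\mathbb Q}$ is the corresponding subgroup, $H_i^*$ is the largest convex subgroup properly contained in $H_i$, and $Q_i=H_i/H_i^*$ (of rank one). For an ordered set $J$ and ordered groups $G_j$, the Hahn product $(\prod_{j\in J}G_j)_{\mathrm{lex}}$ is the group of elements of $\prod_j G_j$ with well-ordered support, ordered lexicographically; it is written $G^J_{\mathrm{lex}}$ if all $G_j=G$ (and $\mathbb R^\emptyset_{\mathrm{lex}}=\{0\}$). Fix ordered-group embeddings $Q_i\hookrightarrow\mathbb R$, and fix (Hahn's embedding theorem) an immediate embedding of $\Gamma_{\mathbb Q}$ into $\mathbb H(\Gamma_{\mathbb Q})=(\prod_{i\in I}Q_i)_{\mathrm{lex}}$,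 i.e. an ordered-group embedding such that an element generating $H_i$ as a convex subgroup has image with zero coordinates at all $j<i$ and with $i$-th coordinate its class in $Q_i$. Identify $\Gamma\subset\Gamma_{\mathbb Q}\subset\mathbb H(\Gamma_{\mathbb Q})\subset\mathbb R^I_{\mathrm{lex}}$. $\mathrm{Init}(I)$ is the set of initial segments of $I$ (including $\emptyset$ and $I$), ordered by inclusion. $\mathbb I=I\sqcup\{i_S\mid S\in\mathrm{Init}(I)\}$ with the total order extending that of $I$ such that $S<i_S<I\setminus S$ for all $S$, and $i_S<i_T\Leftrightarrow S\subsetneq T$. $I_S=I\cup\{i_S\}\subset\mathbb I$. For $J\subset J'\subset \mathbb I$, regard $\mathbb R^J_{\mathrm{lex}}\subset\mathbb R^{J'}_{\mathrm{lex}}$ via extension by zero. For $\beta\in\mathbb R^I_{\mathrm{lex}}$ and $S\in\mathrm{Init}(I)$ let $\beta_S\in\mathbb R^S_{\mathrm{lex}}$ be the restriction of $\beta$ to $S$; for $\rho\in \mathbb R^S_{\mathrm{lex}}$ let $(\rho\mid0)$ be its extension by zero. An element $\rho\in\mathbb R^S_{\mathrm{lex}}$ is commensurable if $\rho=b_S$ for some $b\in\Gamma_{\mathbb Q}$, incommensurable otherwise. $\mathrm{EqRk}(\Gamma)$ is the set of minimal incommensurable elements: those $\beta\in\mathbb R^I_{\mathrm{lex}}$ for which there is a smallest $S\in\mathrm{Init}(I)$ with $\beta_S$ incommensurable, and $\beta=(\beta_S\mid0)$ for this $S$. $\mathrm{IncRk}(\Gamma)$ is the set of all elements $b^{\pm}=(b\mid\pm1\mid0)\in\mathbb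 R^{I_S}_{\mathrm{lex}}$, with $S\in\mathrm{Init}(I)$ and $b\in\mathbb R^S_{\mathrm{lex}}$ commensurable, whose restriction to $S$ is $b$, whose $i_S$-coordinate is $\pm1$, and whose other coordinates are $0$. Finally $\Gamma_{\mathbb R}=\Gamma_{\mathbb Q}\sqcup\mathrm{EqRk}(\Gamma)$ and $\Gamma_{\mathrm{sme}}=\Gamma_{\mathbb R}\sqcup\mathrm{IncRk}(\Gamma)\subset\mathbb R^{\mathbb I}_{\mathrm{lex}}$, with the induced order. *)

theory Defs
  imports Complex_Main "HOL-Library.Set_Algebras"
begin

section \<open>The divisible hull\<close>

primrec nmul :: "nat \<Rightarrow> 'g::monoid_add \<Rightarrow> 'g" where
  "nmul 0 x = 0"
| "nmul (Suc n) x = x + nmul n x"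

lemma nmul_1 [simp]: "nmul (Suc 0) x = x"
  by simp

lemma nmul_zero [simp]: "nmul n (0::'g::monoid_add) = 0"
  by (induction n) auto

lemma nmul_add: "nmul (m + n) x = nmul m x + nmul n (x::'g::monoid_add)"
  by (induction m) (auto simp: add.assoc)

lemma nmul_mult: "nmul m (nmul n x) = nmul (m * n) (x::'g::monoid_add)"
  by (induction m) (auto simp: nmul_add)

lemma nmul_distrib: "nmul n (x + y) = nmul n x + nmul n (y::'g::comm_monoid_add)"
  by (induction n) (auto simp: ac_simps)

lemma nmul_minus: "nmul n (- x) = - nmul n (x::'g::ab_group_add)"
  by (induction n) auto

lemma nmul_less: "0 < n \<Longrightarrow> nmul n x < nmul n y \<longleftrightarrow> x < (y::'g::linordered_ab_group_add)"
proof -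
  assume n: "0 < n"
  have *: "nmul n x < nmul n y" if "x < y" "0 < n" for n and x y :: 'g
    using that(2)
  proof (induction n)
    case (Suc n)
    then show ?case using that(1) by (cases n) (auto intro: add_strict_mono)
  qed auto
  show ?thesis using *[OF _ n] by (metis less_asym linorder_neqE)
qed

lemma nmul_inject: "0 < n \<Longrightarrow> nmul n x = nmul n y \<longleftrightarrow> x = (y::'g::linordered_ab_group_add)"
  by (metis nmul_less less_irrefl linorder_neqE)

lemma nmul_le: "0 < n \<Longrightarrow> nmul n x \<le> nmul n y \<longleftrightarrow> x \<le> (y::'g::linordered_ab_group_add)"
  by (simp add: le_less nmul_less nmul_inject)

text \<open>
  \<open>\<Gamma> \<otimes> \<rat>\<close> is realised as the group of fractions \<open>a/n\<close> with \<open>a \<in> \<Gamma>\<close> and \<open>n\<close> a positive integer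
  (\<open>a/n\<close> being the tensor \<open>a \<otimes> 1/n\<close>), where \<open>a/m = b/n\<close> iff \<open>n a = m b\<close> (an ordered group has no
  torsion) and \<open>a/m < b/n\<close> iff \<open>n a < m b\<close>.
\<close>

definition dhrel :: "('a::linordered_ab_group_add \<times> nat) \<Rightarrow> ('a \<times> nat) \<Rightarrow> bool" where
  "dhrel = (\<lambda>(a, m) (b, n). 0 < m \<and> 0 < n \<and> nmul n a = nmul m b)"

lemma nmul_cross:
  "nmul k (nmul n a) = nmul n (nmul k (a::'g::monoid_add))"
  by (simp add: nmul_mult mult.commute)

lemma part_equivp_dhrel: "part_equivp (dhrel :: 'a::linordered_ab_group_add \<times> nat \<Rightarrow> _)"
proof (rule part_equivpI)
  show "\<exists>x::'a \<times> nat. dhrel x x" by (intro exI[of _ "(0, 1)"]) (simp add: dhrel_def)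
  show "symp (dhrel :: 'a \<times> nat \<Rightarrow> _)" by (auto simp: symp_def dhrel_def)
  show "transp (dhrel :: 'a \<times> nat \<Rightarrow> _)"
  proof (rule transpI)
    fix x y z :: "'a \<times> nat"
    assume xy: "dhrel x y" and yz: "dhrel y z"
    obtain a m b n c k where xyz: "x = (a, m)" "y = (b, n)" "z = (c, k)"
      by (metis prod.exhaust)
    have pos: "0 < m" "0 < n" "0 < k" and 1: "nmul n a = nmul m b" and 2: "nmul k b = nmul n c"
      using xy yz by (auto simp: xyz dhrel_def)
    have "nmul n (nmul k a) = nmul k (nmul n a)" by (rule nmul_cross)
    also have "\<dots> = nmul m (nmul k b)" by (simp only: 1 nmul_cross[of k m])
    also have "\<dots> = nmul n (nmul m c)" by (simp only: 2 nmul_cross[of m n])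
    finally show "dhrel x z" using pos by (simp add: xyz dhrel_def nmul_inject)
  qed
qed

quotient_type (overloaded) 'a dhull = "'a::linordered_ab_group_add \<times> nat" / partial: dhrel
  by (rule part_equivp_dhrel)

instantiation dhull :: (linordered_ab_group_add) linordered_ab_group_add
begin

lift_definition zero_dhull :: "'a dhull" is "(0, 1)"
  by (simp add: dhrel_def)

lift_definition plus_dhull :: "'a dhull \<Rightarrow> 'a dhull \<Rightarrow> 'a dhull"
  is "\<lambda>(a, m) (b, n). (nmul n a + nmul m b, m * n)"
proof (clarsimp simp: dhrel_def nmul_distrib nmul_mult)
  fix a a' b b' :: 'a and m m' n n' :: nat
  assume 1: "nmul m' a = nmul m a'" and 2: "nmul n' b = nmul n b'"
  have "nmul (m' * n' * n) a = nmul (n' * n) (nmul m' a)" by (simp add: nmul_mult ac_simps)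
  also have "\<dots> = nmul (m * n * n') a'" by (simp only: 1) (simp add: nmul_mult ac_simps)
  finally have A: "nmul (m' * n' * n) a = nmul (m * n * n') a'" .
  have "nmul (m' * n' * m) b = nmul (m' * m) (nmul n' b)" by (simp add: nmul_mult ac_simps)
  also have "\<dots> = nmul (m * n * m') b'" by (simp only: 2) (simp add: nmul_mult ac_simps)
  finally show "nmul (m' * n' * n) a + nmul (m' * n' * m) b = nmul (m * n * n') a' + nmul (m * n * m') b'"
    using A by simp
qed

lift_definition uminus_dhull :: "'a dhull \<Rightarrow> 'a dhull" is "\<lambda>(a, m). (- a, m)"
  by (clarsimp simp: dhrel_def nmul_minus)

definition minus_dhull :: "'a dhull \<Rightarrow> 'a dhull \<Rightarrow> 'a dhull" where
  "minus_dhull x y = x + - y"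

lift_definition less_eq_dhull :: "'a dhull \<Rightarrow> 'a dhull \<Rightarrow> bool"
  is "\<lambda>(a, m) (b, n). nmul n a \<le> nmul m b"
proof (clarsimp simp: dhrel_def)
  fix a a' b b' :: 'a and m m' n n' :: nat
  assume pos: "0 < m" "0 < m'" "0 < n" "0 < n'"
    and 1: "nmul m' a = nmul m a'" and 2: "nmul n' b = nmul n b'"
  have a: "nmul (m' * n') (nmul n a) = nmul (m * n) (nmul n' a')"
    using arg_cong[OF 1, of "nmul (n' * n)"] by (simp add: nmul_mult ac_simps)
  have b: "nmul (m' * n') (nmul m b) = nmul (m * n) (nmul m' b')"
    using arg_cong[OF 2, of "nmul (m' * m)"] by (simp add: nmul_mult ac_simps)
  have "nmul n a \<le> nmul m b \<longleftrightarrow> nmul (m' * n') (nmul n a) \<le> nmul (m' * n') (nmul m b)"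
    using pos by (simp add: nmul_le del: nmul.simps)
  also have "\<dots> \<longleftrightarrow> nmul n' a' \<le> nmul m' b'"
    using pos unfolding a b by (simp add: nmul_le)
  finally show "nmul n a \<le> nmul m b \<longleftrightarrow> nmul n' a' \<le> nmul m' b'" .
qed

definition less_dhull :: "'a dhull \<Rightarrow> 'a dhull \<Rightarrow> bool" where
  "less_dhull x y \<longleftrightarrow> x \<le> y \<and> \<not> y \<le> x"

instance
proof
  fix x y z :: "'a dhull"
  show "x + y + z = x + (y + z)"
    by transfer (clarsimp simp: dhrel_def nmul_distrib nmul_mult ac_simps)
  show "x + y = y + x"
    by transfer (clarsimp simp: dhrel_def nmul_distrib nmul_mult ac_simps)
  show "0 + x = x"
    by transfer (clarsimp simp: dhrel_def)
  show "- x + x = 0"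
    by transfer (clarsimp simp: dhrel_def nmul_minus)
  show "x - y = x + - y" by (rule minus_dhull_def)
  show "x < y \<longleftrightarrow> x \<le> y \<and> \<not> y \<le> x" by (rule less_dhull_def)
  show "x \<le> x" by transfer clarsimp
  show "x \<le> z" if "x \<le> y" "y \<le> z"
    using that
  proof (transfer, clarsimp simp: dhrel_def)
    fix a b c :: 'a and m n k :: nat
    assume pos: "0 < m" "0 < n" "0 < k"
      and 1: "nmul n a \<le> nmul m b" and 2: "nmul k b \<le> nmul n c"
    have "nmul n (nmul k a) = nmul k (nmul n a)" by (rule nmul_cross)
    also have "\<dots> \<le> nmul k (nmul m b)" using 1 pos by (simp add: nmul_le)
    also have "\<dots> = nmul m (nmul k b)" by (rule nmul_cross)
    also have "\<dots> \<le> nmul m (nmul n c)" using 2 pos by (simp add: nmul_le)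
    also have "\<dots> = nmul n (nmul m c)" by (rule nmul_cross)
    finally show "nmul k a \<le> nmul m c" using pos by (simp add: nmul_le)
  qed
  show "x = y" if "x \<le> y" "y \<le> x"
    using that by transfer (clarsimp simp: dhrel_def)
  show "x \<le> y \<or> y \<le> x"
    by transfer auto
  show "z + x \<le> z + y" if "x \<le> y"
    using that
  proof (transfer, clarsimp simp: dhrel_def)
    fix a b c :: 'a and m n k :: nat
    assume pos: "0 < m" "0 < n" "0 < k" and 1: "nmul n a \<le> nmul m b"
    have "nmul (k * k) (nmul n a) \<le> nmul (k * k) (nmul m b)" using 1 pos by (simp add: nmul_le)
    then show "nmul (k * n) (nmul m c + nmul k a) \<le> nmul (k * m) (nmul n c + nmul k b)"
      by (simp add: nmul_distrib nmul_mult ac_simps)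
  qed
qed

end

lift_definition dfrac :: "'a::linordered_ab_group_add \<Rightarrow> nat \<Rightarrow> 'a dhull"
  is "\<lambda>a n. if n = 0 then (0, 1) else (a, n)"
  by (simp add: dhrel_def)

lemma dfrac_eq: "0 < m \<Longrightarrow> 0 < n \<Longrightarrow> dfrac a m = dfrac b n \<longleftrightarrow> nmul n a = nmul m b"
  by transfer (simp add: dhrel_def)

lemma dfrac_le: "0 < m \<Longrightarrow> 0 < n \<Longrightarrow> dfrac a m \<le> dfrac b n \<longleftrightarrow> nmul n a \<le> nmul m b"
  by transfer simp

lemma dfrac_less: "0 < m \<Longrightarrow> 0 < n \<Longrightarrow> dfrac a m < dfrac b n \<longleftrightarrow> nmul n a < nmul m b"
  by (metis dfrac_le not_le)

lemma dfrac_add: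
  "0 < m \<Longrightarrow> 0 < n \<Longrightarrow> dfrac a m + dfrac b n = dfrac (nmul n a + nmul m b) (m * n)"
  by transfer (simp add: dhrel_def)

lemma dfrac_cases:
  obtains a n where "0 < n" "x = dfrac a n"
proof -
  have "\<exists>a n. 0 < n \<and> x = dfrac a n"
    by transfer (auto simp: dhrel_def)
  then show thesis using that by blast
qed

definition to_dhull :: "'a::linordered_ab_group_add \<Rightarrow> 'a dhull" where
  "to_dhull a = dfrac a 1"

lemma to_dhull_add: "to_dhull (a + b) = to_dhull a + to_dhull b"
  by (simp add: to_dhull_def dfrac_add)

lemma to_dhull_less: "to_dhull a < to_dhull b \<longleftrightarrow> a < b"
  by (simp add: to_dhull_def dfrac_less)

lemma nmul_dfrac: "0 < n \<Longrightarrow> nmul k (dfrac a n) = dfrac (nmul k a) n"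
proof (induction k)
  case 0
  then show ?case by simp (transfer, simp add: dhrel_def)
next
  case (Suc k)
  then show ?case by (simp add: dfrac_add dfrac_eq nmul_distrib nmul_mult ac_simps)
qed

lemma dhull_fraction: "\<exists>n a. 0 < n \<and> nmul n x = to_dhull a"
proof (cases x rule: dfrac_cases)
  case (1 a n)
  then have "nmul n x = to_dhull a" by (simp add: nmul_dfrac to_dhull_def dfrac_eq)
  with 1 show ?thesis by blast
qed

lemma dhull_divisible: "0 < k \<Longrightarrow> \<exists>y. nmul k y = (x::'a::linordered_ab_group_add dhull)"
proof (cases x rule: dfrac_cases)
  case (1 a n)
  assume "0 < k"
  with 1 have "nmul k (dfrac a (k * n)) = x"
    by (simp add: nmul_dfrac dfrac_eq nmul_mult ac_simps)
  then show ?thesis by blast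
qed


section \<open>Convex subgroups\<close>

text \<open>\<open>max x (- x)\<close> is \<open>\<bar>x\<bar>\<close>; the class \<^class>\<open>linordered_ab_group_add\<close> has no absolute value.\<close>

definition convex_subgroup :: "'g::linordered_ab_group_add set \<Rightarrow> bool" where
  "convex_subgroup H \<longleftrightarrow>
     0 \<in> H \<and> (\<forall>x\<in>H. \<forall>y\<in>H. x - y \<in> H) \<and>
     (\<forall>\<gamma>\<in>H. \<forall>\<rho>. max \<rho> (- \<rho>) \<le> max \<gamma> (- \<gamma>) \<longrightarrow> \<rho> \<in> H)"

definition convex_generated :: "'g::linordered_ab_group_add \<Rightarrow> 'g set" where
  "convex_generated g = \<Inter> {H. convex_subgroup H \<and> g \<in> H}"

definition Prin :: "'g::linordered_ab_group_add set set" where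
  "Prin = {H. H \<noteq> {0} \<and> (\<exists>g. H = convex_generated g)}"

text \<open>The order of \<open>I\<close> (decreasing inclusion), as a reflexive relation with \<open>(i, j)\<close> meaning \<open>i \<le> j\<close>.\<close>

definition Prin_ord :: "'g::linordered_ab_group_add set rel" where
  "Prin_ord = {(i, j). i \<in> Prin \<and> j \<in> Prin \<and> j \<subseteq> i}"

text \<open>\<open>H_star i\<close> is \<open>H\<^sub>i\<^sup>*\<close>; the index \<open>i\<close> is the subgroup \<open>H\<^sub>i\<close> itself.\<close>

definition H_star :: "'g::linordered_ab_group_add set \<Rightarrow> 'g set" where
  "H_star i = (GREATEST K. convex_subgroup K \<and> K \<subset> i)"

lemma convex_subgroup_linear:
  assumes "convex_subgroup H" "convex_subgroup K"
  shows "H \<subseteq> K \<or> K \<subseteq> H"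
proof (rule ccontr)
  assume "\<not> ?thesis"
  then obtain x y where "x \<in> H" "x \<notin> K" "y \<in> K" "y \<notin> H" by blast
  moreover have "max x (- x) \<le> max y (- y) \<or> max y (- y) \<le> max x (- x)"
    by (rule linear)
  ultimately show False
    using assms unfolding convex_subgroup_def by blast
qed

lemma convex_subgroup_convex_generated: "convex_subgroup (convex_generated g)"
  unfolding convex_subgroup_def convex_generated_def by blast

lemma convex_generated_self: "g \<in> convex_generated g"
  by (simp add: convex_generated_def)

lemma convex_generated_least: "convex_subgroup H \<Longrightarrow> g \<in> H \<Longrightarrow> convex_generated g \<subseteq> H"
  by (auto simp: convex_generated_def)

lemma convex_subgroup_Prin: "i \<in> Prin \<Longrightarrow> convex_subgroup i"
  by (auto simp: Prin_def convex_subgroup_convex_generated)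

lemma linear_order_on_Prin_ord: "linear_order_on Prin Prin_ord"
  unfolding order_on_defs refl_on_def trans_def antisym_def total_on_def Prin_ord_def
  using convex_subgroup_linear convex_subgroup_Prin by blast

lemma H_star_greatest:
  assumes "i \<in> Prin"
  shows "convex_subgroup (H_star i)" "H_star i \<subset> i"
    and "\<And>K. convex_subgroup K \<Longrightarrow> K \<subset> i \<Longrightarrow> K \<subseteq> H_star i"
proof -
  obtain g where g: "i = convex_generated g" and "i \<noteq> {0}"
    using assms by (auto simp: Prin_def)
  let ?P = "\<lambda>K. convex_subgroup K \<and> K \<subset> i"
  let ?U = "\<Union> {K. ?P K}"
  have zero: "?P {0}"
    using assms \<open>i \<noteq> {0}\<close> convex_subgroup_Prin[OF assms]
    by (auto simp: convex_subgroup_def max_def split: if_splits)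
  have "g \<notin> ?U"
    using convex_generated_least g by blast
  then have sub: "?U \<subset> i"
    using convex_generated_self[of g] g by blast
  have "x - y \<in> ?U" if xy: "x \<in> ?U" "y \<in> ?U" for x y
  proof -
    obtain K where K: "?P K" "x \<in> K" using xy(1) by blast
    obtain L where L: "?P L" "y \<in> L" using xy(2) by blast
    note KL = K L
    consider "K \<subseteq> L" | "L \<subseteq> K" using KL convex_subgroup_linear by blast
    then show ?thesis
    proof cases
      case 1
      then have "x - y \<in> L" using KL unfolding convex_subgroup_def by blast
      then show ?thesis using KL by blast
    next
      case 2
      then have "x - y \<in> K" using KL unfolding convex_subgroup_def by blast
      then show ?thesis using KL by blast
    qed
  qed
  moreover have "\<rho> \<in> ?U" if \<gamma>: "\<gamma> \<in> ?U" and le: "max \<rho> (- \<rho>) \<le> max \<gamma> (- \<gamma>)" for \<rho> \<gamma>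
  proof -
    obtain K where K: "?P K" "\<gamma> \<in> K" using \<gamma> by blast
    then have "\<rho> \<in> K" using le unfolding convex_subgroup_def by blast
    then show ?thesis using K by blast
  qed
  moreover have "0 \<in> ?U" using zero by blast
  ultimately have "convex_subgroup ?U"
    by (intro iffD2[OF convex_subgroup_def] conjI ballI allI impI)
  with sub have "H_star i = ?U"
    unfolding H_star_def by (intro Greatest_equality) auto
  with sub \<open>convex_subgroup ?U\<close>
  show "convex_subgroup (H_star i)" "H_star i \<subset> i"
    and "\<And>K. convex_subgroup K \<Longrightarrow> K \<subset> i \<Longrightarrow> K \<subseteq> H_star i"
    by auto
qed

text \<open>
  The quotient \<open>Q\<^sub>i = H\<^sub>i / H\<^sub>i\<^sup>*\<close> consists of cosets. They are added as sets (Minkowski sum),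
  and the zero element is the coset \<open>H\<^sub>i\<^sup>*\<close>.
\<close>

definition Q :: "'g::linordered_ab_group_add set \<Rightarrow> 'g set set" where
  "Q i = {x +o H_star i | x. x \<in> i}"

definition coset_less :: "'g::linordered_ab_group_add set \<Rightarrow> 'g set \<Rightarrow> bool" where
  "coset_less C D \<longleftrightarrow> C \<noteq> D \<and> (\<exists>x\<in>C. \<exists>y\<in>D. x < y)"

definition Q_embedding :: "'g::linordered_ab_group_add set \<Rightarrow> ('g set \<Rightarrow> real) \<Rightarrow> bool" where
  "Q_embedding i e \<longleftrightarrow>
     (\<forall>C\<in>Q i. \<forall>D\<in>Q i. e (C + D) = e C + e D) \<and>
     (\<forall>C\<in>Q i. \<forall>D\<in>Q i. coset_less C D \<longrightarrow> e C < e D)"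


section \<open>Hahn products\<close>

text \<open>
  The groups \<open>G j\<close> with zero elements \<open>z j\<close> are indexed by \<open>j \<in> J\<close>, where \<open>r\<close> is a reflexive
  relation that orders \<open>J\<close>. Elements are total functions equal to \<open>z j\<close> at all \<open>j \<notin> J\<close>, so that for
  \<open>J \<subseteq> J'\<close> extension by zero is the identity.
\<close>

definition hahn_product :: "'i set \<Rightarrow> 'i rel \<Rightarrow> ('i \<Rightarrow> 'b set) \<Rightarrow> ('i \<Rightarrow> 'b) \<Rightarrow> ('i \<Rightarrow> 'b) set" where
  "hahn_product J r G z =
     {f. (\<forall>j\<in>J. f j \<in> G j) \<and> (\<forall>j. j \<notin> J \<longrightarrow> f j = z j) \<and>
         (let supp = {j\<in>J. f j \<noteq> z j} in well_order_on supp (r \<inter> supp \<times> supp))}"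

definition lex_less :: "'i set \<Rightarrow> 'i rel \<Rightarrow> ('b \<Rightarrow> 'b \<Rightarrow> bool) \<Rightarrow> ('i \<Rightarrow> 'b) \<Rightarrow> ('i \<Rightarrow> 'b) \<Rightarrow> bool" where
  "lex_less J r lt f g \<longleftrightarrow>
     (\<exists>j\<in>J. lt (f j) (g j) \<and> (\<forall>i\<in>J. (i, j) \<in> r \<and> i \<noteq> j \<longrightarrow> f i = g i))"

definition immediate_embedding :: "('g::linordered_ab_group_add \<Rightarrow> 'g set \<Rightarrow> 'g set) \<Rightarrow> bool" where
  "immediate_embedding \<phi> \<longleftrightarrow>
     (\<forall>x. \<phi> x \<in> hahn_product Prin Prin_ord Q H_star) \<and>
     (\<forall>x y. \<forall>i\<in>Prin. \<phi> (x + y) i = \<phi> x i + \<phi> y i) \<and>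
     (\<forall>x y. x < y \<longrightarrow> lex_less Prin Prin_ord coset_less (\<phi> x) (\<phi> y)) \<and>
     (\<forall>x. \<forall>i\<in>Prin. convex_generated x = i \<longrightarrow>
        (\<forall>j\<in>Prin. (j, i) \<in> Prin_ord \<and> j \<noteq> i \<longrightarrow> \<phi> x j = H_star j) \<and> \<phi> x i = x +o H_star i)"


section \<open>The extended index set\<close>

definition Init :: "'g::linordered_ab_group_add set set set" where
  "Init = {S. S \<subseteq> Prin \<and> (\<forall>i\<in>S. \<forall>j. (j, i) \<in> Prin_ord \<longrightarrow> j \<in> S)}"

text \<open>\<open>Pt i\<close> is the index \<open>i \<in> I\<close>, and \<open>Gap S\<close> is \<open>i\<^sub>S\<close>.\<close>

datatype 'i ext = Pt 'i | Gap "'i set"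

definition II :: "'g::linordered_ab_group_add set ext set" where
  "II = Pt ` Prin \<union> Gap ` Init"

fun ext_le :: "'g::linordered_ab_group_add set ext \<Rightarrow> 'g set ext \<Rightarrow> bool" where
  "ext_le (Pt i) (Pt j) \<longleftrightarrow> (i, j) \<in> Prin_ord"
| "ext_le (Pt i) (Gap S) \<longleftrightarrow> i \<in> S"
| "ext_le (Gap S) (Pt i) \<longleftrightarrow> i \<notin> S"
| "ext_le (Gap S) (Gap T) \<longleftrightarrow> S \<subseteq> T"

definition II_ord :: "'g::linordered_ab_group_add set ext rel" where
  "II_ord = {(k, l). k \<in> II \<and> l \<in> II \<and> ext_le k l}"

lemma Init_linear:
  assumes "S \<in> Init" "T \<in> Init"
  shows "S \<subseteq> T \<or> T \<subseteq> S"
proof (rule ccontr)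
  assume "\<not> ?thesis"
  then obtain i j where ij: "i \<in> S" "i \<notin> T" "j \<in> T" "j \<notin> S" by blast
  then have "i \<in> Prin" "j \<in> Prin" "i \<noteq> j" using assms by (auto simp: Init_def)
  then have "(i, j) \<in> Prin_ord \<or> (j, i) \<in> Prin_ord"
    using linear_order_on_Prin_ord by (auto simp: linear_order_on_def total_on_def)
  then show False using assms ij by (auto simp: Init_def)
qed

lemma linear_order_on_II_ord:
  "linear_order_on II (II_ord :: 'a::linordered_ab_group_add set ext rel)"
proof -
  have Prin: "refl_on Prin (Prin_ord :: 'a set rel)" "trans (Prin_ord :: 'a set rel)"
    "antisym (Prin_ord :: 'a set rel)" "total_on Prin (Prin_ord :: 'a set rel)"
    using linear_order_on_Prin_ord by (auto simp: order_on_defs)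
  have total: "(i, j) \<in> Prin_ord \<or> (j, i) \<in> Prin_ord" if "i \<in> Prin" "j \<in> Prin" "i \<noteq> j" for i j :: "'a set"
    using Prin(4) that by (auto simp: total_on_def)
  have Init: "j \<in> S" if "S \<in> Init" "i \<in> S" "(j, i) \<in> Prin_ord" for i j and S :: "'a set set"
    using that by (auto simp: Init_def)
  have "refl_on II (II_ord :: 'a set ext rel)"
    using Prin(1) by (auto simp: refl_on_def II_def II_ord_def)
  moreover have "trans (II_ord :: 'a set ext rel)"
  proof (rule transI)
    fix k l m :: "'a set ext"
    assume "(k, l) \<in> II_ord" "(l, m) \<in> II_ord"
    then have II: "k \<in> II" "l \<in> II" "m \<in> II" and le: "ext_le k l" "ext_le l m"
      by (auto simp: II_ord_def)
    have "ext_le k m"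
    proof (cases k; cases l; cases m)
      fix i S j assume "k = Pt i" "l = Gap S" "m = Pt j"
      then have "i \<in> Prin" "j \<in> Prin" "S \<in> Init" "i \<in> S" "j \<notin> S"
        using II le by (auto simp: II_def)
      then show "ext_le k m"
        using total[of i j] Init[of S i j] \<open>k = Pt i\<close> \<open>m = Pt j\<close>
        by auto
    next
      fix S i T assume "k = Gap S" "l = Pt i" "m = Gap T"
      then show "ext_le k m"
        using II le Init_linear[of S T] by (auto simp: II_def)
    qed (use II le in \<open>auto simp: II_def dest: Init transD[OF Prin(2)]\<close>)
    then show "(k, m) \<in> II_ord" using II by (simp add: II_ord_def)
  qed
  moreover have "antisym (II_ord :: 'a set ext rel)"
  proof (rule antisymI)
    fix k l :: "'a set ext"
    assume "(k, l) \<in> II_ord" "(l, k) \<in> II_ord"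
    then have "ext_le k l" "ext_le l k" by (auto simp: II_ord_def)
    then show "k = l"
      by (cases k; cases l) (auto dest: antisymD[OF Prin(3)])
  qed
  moreover have "total_on II (II_ord :: 'a set ext rel)"
  proof (rule total_onI)
    fix k l :: "'a set ext"
    assume II: "k \<in> II" "l \<in> II" and "k \<noteq> l"
    then have "ext_le k l \<or> ext_le l k"
      using Init_linear by (cases k; cases l) (auto simp: II_def dest: total)
    then show "(k, l) \<in> II_ord \<or> (l, k) \<in> II_ord" using II by (simp add: II_ord_def)
  qed
  moreover have "(II_ord :: 'a set ext rel) \<subseteq> II \<times> II"
    by (auto simp: II_ord_def)
  ultimately show ?thesis by (simp add: order_on_defs)
qed

text \<open>\<open>R_lex J\<close> is \<open>\<real>\<^sup>J\<^sub>l\<^sub>e\<^sub>x\<close> for \<open>J \<subseteq> II\<close>.\<close>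

definition R_lex :: "'g::linordered_ab_group_add set ext set \<Rightarrow> ('g set ext \<Rightarrow> real) set" where
  "R_lex J = hahn_product J II_ord (\<lambda>_. UNIV) (\<lambda>_. 0)"

text \<open>
  For \<open>S \<in> Init\<close> the restriction \<open>\<beta>\<^sub>S\<close>. As functions, \<open>\<beta>\<^sub>S\<close> and \<open>(\<beta>\<^sub>S | 0)\<close> are the same.
\<close>

definition restr :: "('g::linordered_ab_group_add set ext \<Rightarrow> real) \<Rightarrow> 'g set set \<Rightarrow> 'g set ext \<Rightarrow> real" where
  "restr \<beta> S = (\<lambda>k. if k \<in> Pt ` S then \<beta> k else 0)"


section \<open>The small-extensions closure\<close>

text \<open>
  Below, \<open>e i\<close> is the embedding \<open>Q\<^sub>i \<rightarrow> \<real>\<close> and \<open>\<phi>\<close> is the immediate embedding of \<open>\<Gamma>\<^sub>\<rat>\<close> into its Hahn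
  product. \<open>realize e \<phi>\<close> is the resulting map from \<open>\<Gamma>\<^sub>\<rat>\<close> into \<open>\<real>\<^sup>I\<^sub>l\<^sub>e\<^sub>x\<close>.
\<close>

type_synonym 'g embs = "'g set \<Rightarrow> 'g set \<Rightarrow> real"
type_synonym 'g hahn_emb = "'g \<Rightarrow> 'g set \<Rightarrow> 'g set"

definition realize ::
  "'g::linordered_ab_group_add embs \<Rightarrow> 'g hahn_emb \<Rightarrow> 'g \<Rightarrow> 'g set ext \<Rightarrow> real" where
  "realize e \<phi> x = (\<lambda>k. case k of Pt i \<Rightarrow> if i \<in> Prin then e i (\<phi> x i) else 0 | Gap S \<Rightarrow> 0)"

definition Gamma_Q ::
  "'a::linordered_ab_group_add dhull embs \<Rightarrow> 'a dhull hahn_emb \<Rightarrow> ('a dhull set ext \<Rightarrow> real) set" where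
  "Gamma_Q e \<phi> = range (realize e \<phi>)"

definition commensurable ::
  "'a::linordered_ab_group_add dhull embs \<Rightarrow> 'a dhull hahn_emb \<Rightarrow> 'a dhull set set \<Rightarrow>
     ('a dhull set ext \<Rightarrow> real) \<Rightarrow> bool" where
  "commensurable e \<phi> S \<rho> \<longleftrightarrow> \<rho> \<in> R_lex (Pt ` S) \<and> (\<exists>b\<in>Gamma_Q e \<phi>. \<rho> = restr b S)"

definition incommensurable ::
  "'a::linordered_ab_group_add dhull embs \<Rightarrow> 'a dhull hahn_emb \<Rightarrow> 'a dhull set set \<Rightarrow>
     ('a dhull set ext \<Rightarrow> real) \<Rightarrow> bool" where
  "incommensurable e \<phi> S \<rho> \<longleftrightarrow> \<rho> \<in> R_lex (Pt ` S) \<and> \<not> commensurable e \<phi> S \<rho>"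

definition EqRk ::
  "'a::linordered_ab_group_add dhull embs \<Rightarrow> 'a dhull hahn_emb \<Rightarrow> ('a dhull set ext \<Rightarrow> real) set" where
  "EqRk e \<phi> =
     {\<beta> \<in> R_lex (Pt ` Prin).
        \<exists>S\<in>Init. incommensurable e \<phi> S (restr \<beta> S) \<and>
          (\<forall>T\<in>Init. incommensurable e \<phi> T (restr \<beta> T) \<longrightarrow> S \<subseteq> T) \<and>
          \<beta> = restr \<beta> S}"

text \<open>An update of \<open>b \<in> \<real>\<^sup>S\<^sub>l\<^sub>e\<^sub>x\<close> at \<open>i\<^sub>S\<close> gives \<open>b\<^sup>\<plusminus> = (b | \<plusminus>1 | 0)\<close>.\<close>

definition IncRk ::
  "'a::linordered_ab_group_add dhull embs \<Rightarrow> 'a dhull hahn_emb \<Rightarrow> ('a dhull set ext \<Rightarrow> real) set" where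
  "IncRk e \<phi> =
     {b(Gap S := s) | b S s. S \<in> Init \<and> commensurable e \<phi> S b \<and> s \<in> {1, -1}}"

definition Gamma_R ::
  "'a::linordered_ab_group_add dhull embs \<Rightarrow> 'a dhull hahn_emb \<Rightarrow> ('a dhull set ext \<Rightarrow> real) set" where
  "Gamma_R e \<phi> = Gamma_Q e \<phi> \<union> EqRk e \<phi>"

definition Gamma_sme ::
  "'a::linordered_ab_group_add dhull embs \<Rightarrow> 'a dhull hahn_emb \<Rightarrow> ('a dhull set ext \<Rightarrow> real) set" where
  "Gamma_sme e \<phi> = Gamma_R e \<phi> \<union> IncRk e \<phi>"

text \<open>The order induced on \<open>\<Gamma>\<^sub>s\<^sub>m\<^sub>e\<close> by the lexicographic order of \<open>R_lex II\<close>, as a reflexive relation.\<close>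

definition sme_ord ::
  "'a::linordered_ab_group_add dhull embs \<Rightarrow> 'a dhull hahn_emb \<Rightarrow> ('a dhull set ext \<Rightarrow> real) rel" where
  "sme_ord e \<phi> =
     {(x, y). x \<in> Gamma_sme e \<phi> \<and> y \<in> Gamma_sme e \<phi> \<and> (x = y \<or> lex_less II II_ord (<) x y)}"

end

theory Submission
  imports Defs
begin

text \<open>
  The elements \<open>b\<^sup>-\<close> and \<open>b\<^sup>+\<close> with \<open>b \<in> \<real>\<^sup>S\<close> commensurable bound the set of all elements that agree
  with \<open>b\<close> below \<open>i\<^sub>S\<close>. Given \<open>X\<close>, take the largest initial segment \<open>S\<close> obtained as a union of
  segments \<open>T\<close> for which the cut of \<open>X\<close> lies between some \<open>b\<^sup>-\<close> and \<open>b\<^sup>+\<close> of level \<open>T\<close>; these \<open>b\<close> are unique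
  and glue to some \<open>\<beta> \<in> \<real>\<^sup>S\<close>. If the cut does not lie between \<open>\<beta>\<^sup>-\<close> and \<open>\<beta>\<^sup>+\<close>, the supremum is \<open>\<beta>\<close>
  or \<open>\<beta>\<^sup>-\<close>. If it does, and neither \<open>\<beta>\<^sup>-\<close> nor \<open>\<beta>\<^sup>+\<close> is the supremum, then either \<open>S = I\<close> and the supremum
  is \<open>\<beta>\<close>, or \<open>I - S\<close> has a least element \<open>j\<close> and the real supremum of the \<open>j\<close>-th coordinates gives the
  next coordinate. If \<open>I - S\<close> has no least element, well-ordered supports force the elements of \<open>X\<close> and its
  upper bounds that agree with \<open>\<beta>\<close> to agree on a longer segment, against the maximality of \<open>S\<close>.
\<close>

section \<open>The extended index set\<close>

definition II_less :: "'g::linordered_ab_group_add set ext \<Rightarrow> 'g set ext \<Rightarrow> bool"  (infix "\<prec>" 50) where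
  "k \<prec> l \<longleftrightarrow> (k, l) \<in> II_ord \<and> k \<noteq> l"

lemma II_less_II: "k \<prec> l \<Longrightarrow> k \<in> II \<and> l \<in> II"
  by (auto simp: II_less_def II_ord_def)

lemma II_less_irrefl: "\<not> k \<prec> k"
  by (simp add: II_less_def)

lemma II_less_trans: "k \<prec> l \<Longrightarrow> l \<prec> m \<Longrightarrow> k \<prec> m"
  using linear_order_on_II_ord unfolding II_less_def order_on_defs
  by (metis antisymD transD)

lemma II_less_linear: "k \<in> II \<Longrightarrow> l \<in> II \<Longrightarrow> k \<prec> l \<or> k = l \<or> l \<prec> k"
  using linear_order_on_II_ord unfolding II_less_def order_on_defs total_on_def by blast

lemma Init_sub: "S \<in> Init \<Longrightarrow> S \<subseteq> Prin"
  by (simp add: Init_def)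

lemma Prin_linear: "i \<in> Prin \<Longrightarrow> j \<in> Prin \<Longrightarrow> (i, j) \<in> Prin_ord \<or> (j, i) \<in> Prin_ord"
  using convex_subgroup_linear convex_subgroup_Prin by (auto simp: Prin_ord_def)

lemma Gap_II [simp]: "Gap S \<in> II \<longleftrightarrow> S \<in> Init"
  and Pt_II [simp]: "Pt i \<in> II \<longleftrightarrow> i \<in> Prin"
  by (auto simp: II_def)

lemma Pt_less_Gap: "S \<in> Init \<Longrightarrow> Pt i \<prec> Gap S \<longleftrightarrow> i \<in> S"
  using Init_sub by (auto simp: II_less_def II_ord_def)

lemma Gap_less_Gap: "S \<in> Init \<Longrightarrow> T \<in> Init \<Longrightarrow> Gap T \<prec> Gap S \<longleftrightarrow> T \<subset> S"
  by (auto simp: II_less_def II_ord_def)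

lemma Gap_less_Pt: "S \<in> Init \<Longrightarrow> Gap S \<prec> Pt i \<longleftrightarrow> i \<in> Prin - S"
  by (auto simp: II_less_def II_ord_def)

lemma Pt_less_Pt: "Pt i \<prec> Pt j \<longleftrightarrow> (i, j) \<in> Prin_ord \<and> i \<noteq> j"
  by (auto simp: II_less_def II_ord_def Prin_ord_def)

lemma less_Gap_cases:
  assumes "k \<prec> Gap S"
  obtains i where "k = Pt i" "i \<in> S" | T where "k = Gap T" "T \<in> Init" "T \<subset> S"
  using assms II_less_II[OF assms]
  by (cases k) (auto simp: Pt_less_Gap Gap_less_Gap)

lemma Init_Union: "\<A> \<subseteq> Init \<Longrightarrow> \<Union>\<A> \<in> Init"
  unfolding Init_def by blast

lemma Init_closed: "S \<in> Init \<Longrightarrow> i \<in> S \<Longrightarrow> (j, i) \<in> Prin_ord \<Longrightarrow> j \<in> S"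
  by (auto simp: Init_def)

lemma Init_below: "{i. (i, j) \<in> Prin_ord} \<in> Init"
  by (auto simp: Init_def Prin_ord_def)

lemma Init_subset_iff:
  assumes "S \<in> Init" "T \<in> Init" "i \<in> S" "i \<notin> T"
  shows "T \<subset> S"
  using Init_linear[OF assms(1,2)] assms by blast

section \<open>Lexicographic comparison below an index\<close>

definition agree_below :: "'g::linordered_ab_group_add set ext \<Rightarrow> ('g set ext \<Rightarrow> real) \<Rightarrow> ('g set ext \<Rightarrow> real) \<Rightarrow> bool" where
  "agree_below m f g \<longleftrightarrow> (\<forall>k. k \<prec> m \<longrightarrow> f k = g k)"

definition less_at :: "'g::linordered_ab_group_add set ext \<Rightarrow> ('g set ext \<Rightarrow> real) \<Rightarrow> ('g set ext \<Rightarrow> real) \<Rightarrow> bool" where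
  "less_at k f g \<longleftrightarrow> k \<in> II \<and> f k < g k \<and> agree_below k f g"

definition less_below :: "'g::linordered_ab_group_add set ext \<Rightarrow> ('g set ext \<Rightarrow> real) \<Rightarrow> ('g set ext \<Rightarrow> real) \<Rightarrow> bool" where
  "less_below m f g \<longleftrightarrow> (\<exists>k. k \<prec> m \<and> less_at k f g)"

definition ext_less :: "('g::linordered_ab_group_add set ext \<Rightarrow> real) \<Rightarrow> ('g set ext \<Rightarrow> real) \<Rightarrow> bool" where
  "ext_less f g \<longleftrightarrow> (\<exists>k. less_at k f g)"

lemma lex_less_ext: "lex_less II II_ord (<) f g \<longleftrightarrow> ext_less f g"
  unfolding lex_less_def ext_less_def less_at_def agree_below_def II_less_def II_ord_def by blast

lemma agree_below_sym: "agree_below m f g \<Longrightarrow> agree_below m g f"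
  by (simp add: agree_below_def)

lemma agree_below_trans: "agree_below m f g \<Longrightarrow> agree_below m g h \<Longrightarrow> agree_below m f h"
  by (simp add: agree_below_def)

lemma agree_below_mono: "agree_below m f g \<Longrightarrow> k \<prec> m \<Longrightarrow> agree_below k f g"
  unfolding agree_below_def using II_less_trans by blast

lemma agree_below_Gap_mono:
  "agree_below (Gap S) f g \<Longrightarrow> T \<subseteq> S \<Longrightarrow> T \<in> Init \<Longrightarrow> S \<in> Init \<Longrightarrow> agree_below (Gap T) f g"
  using agree_below_mono Gap_less_Gap by (metis psubsetI)

lemma less_at_agree:
  "less_at k f g \<Longrightarrow> k \<prec> m \<Longrightarrow> agree_below m f f' \<Longrightarrow> agree_below m g g' \<Longrightarrow> less_at k f' g'"
  unfolding less_at_def agree_below_def by (metis II_less_trans)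

lemma less_below_agree:
  "less_below m f g \<Longrightarrow> agree_below m f f' \<Longrightarrow> agree_below m g g' \<Longrightarrow> less_below m f' g'"
  unfolding less_below_def using less_at_agree by blast

lemma less_below_less: "less_below m f g \<Longrightarrow> ext_less f g"
  unfolding less_below_def ext_less_def by blast

lemma less_at_trans:
  assumes "less_at k f g" "less_at l g h"
  shows "ext_less f h"
proof -
  consider "k \<prec> l" | "k = l" | "l \<prec> k"
    using assms II_less_linear by (auto simp: less_at_def)
  then show ?thesis
  proof cases
    case 1
    then have "less_at k f h"
      using assms II_less_trans[OF _ 1] unfolding less_at_def agree_below_def by metis
    then show ?thesis by (auto simp: ext_less_def)
  next
    case 2
    then have "less_at k f h"
      using assms unfolding less_at_def agree_below_def by force
    then show ?thesis by (auto simp: ext_less_def)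
  next
    case 3
    then have "less_at l f h"
      using assms II_less_trans[OF _ 3] unfolding less_at_def agree_below_def by metis
    then show ?thesis by (auto simp: ext_less_def)
  qed
qed

lemma ext_less_trans: "ext_less f g \<Longrightarrow> ext_less g h \<Longrightarrow> ext_less f h"
  using less_at_trans unfolding ext_less_def by blast

lemma ext_less_irrefl: "\<not> ext_less f f"
  by (simp add: ext_less_def less_at_def)

lemma ext_less_asym: "ext_less f g \<Longrightarrow> \<not> ext_less g f"
  using ext_less_trans ext_less_irrefl by blast

lemma less_below_asym: "less_below m f g \<Longrightarrow> \<not> ext_less g f"
  using less_below_less ext_less_asym by blast

lemma less_at_cases:
  assumes "less_at k f g" "m \<in> II"
  shows "less_below m f g \<or> agree_below m f g \<and> (f m < g m \<or> f m = g m)"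
proof -
  consider "k \<prec> m" | "k = m" | "m \<prec> k"
    using assms II_less_linear by (auto simp: less_at_def)
  then show ?thesis
  proof cases
    case 3
    then have "agree_below m f g" "f m = g m"
      using assms agree_below_mono[of k f g m] by (auto simp: less_at_def agree_below_def)
    then show ?thesis by simp
  qed (use assms in \<open>auto simp: less_below_def less_at_def\<close>)
qed

lemma ext_less_cases:
  assumes "ext_less f g" "m \<in> II"
  obtains "less_below m f g" | "agree_below m f g" "f m < g m" | "agree_below m f g" "f m = g m"
  using assms less_at_cases unfolding ext_less_def by blast

definition wo_supp :: "('g::linordered_ab_group_add set ext \<Rightarrow> real) \<Rightarrow> bool" where
  "wo_supp f \<longleftrightarrow> (\<forall>k. f k \<noteq> 0 \<longrightarrow> k \<in> II) \<and>
     (\<forall>A. A \<noteq> {} \<and> A \<subseteq> {k. f k \<noteq> 0} \<longrightarrow> (\<exists>m\<in>A. \<forall>k\<in>A. \<not> k \<prec> m))"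

lemma wo_suppI:
  assumes "\<And>k. f k \<noteq> 0 \<Longrightarrow> k \<in> II"
    and "\<And>A. A \<noteq> {} \<Longrightarrow> A \<subseteq> {k. f k \<noteq> 0} \<Longrightarrow> \<exists>m\<in>A. \<forall>k\<in>A. \<not> k \<prec> m"
  shows "wo_supp f"
  using assms unfolding wo_supp_def by blast

lemma wo_supp_II: "wo_supp f \<Longrightarrow> f k \<noteq> 0 \<Longrightarrow> k \<in> II"
  by (simp add: wo_supp_def)

lemma wo_supp_min:
  assumes "wo_supp f" "a \<in> A" "A \<subseteq> {k. f k \<noteq> 0}"
  obtains m where "m \<in> A" "\<forall>k\<in>A. \<not> k \<prec> m"
  using assms unfolding wo_supp_def by blast

lemma wo_supp_mono:
  assumes "wo_supp f" "\<And>k. g k \<noteq> 0 \<Longrightarrow> f k \<noteq> 0"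
  shows "wo_supp g"
  using assms unfolding wo_supp_def by (metis (mono_tags, lifting) mem_Collect_eq subset_iff)

lemma wo_supp_restr: "wo_supp f \<Longrightarrow> wo_supp (restr f S)"
  by (erule wo_supp_mono) (auto simp: restr_def split: if_splits)

lemma wo_supp_Un:
  assumes "wo_supp f" "wo_supp g" "\<And>k. h k \<noteq> 0 \<Longrightarrow> f k \<noteq> 0 \<or> g k \<noteq> 0"
  shows "wo_supp h"
proof (rule wo_suppI)
  fix k assume "h k \<noteq> 0"
  then show "k \<in> II" using assms wo_supp_II by metis
next
  fix A assume A: "A \<noteq> {}" "A \<subseteq> {k. h k \<noteq> 0}"
  let ?B = "{k\<in>A. f k \<noteq> 0}" and ?C = "{k\<in>A. g k \<noteq> 0}"
  have A_eq: "A = ?B \<union> ?C" using A assms(3) by blast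
  show "\<exists>m\<in>A. \<forall>k\<in>A. \<not> k \<prec> m"
  proof (cases "?B = {} \<or> ?C = {}")
    case True
    then have "A \<subseteq> {k. f k \<noteq> 0} \<or> A \<subseteq> {k. g k \<noteq> 0}" using A_eq by blast
    then show ?thesis using A assms(1,2) unfolding wo_supp_def by blast
  next
    case False
    then obtain b where b: "b \<in> ?B" "\<forall>k\<in>?B. \<not> k \<prec> b"
      using assms(1) unfolding wo_supp_def by (metis (mono_tags, lifting) mem_Collect_eq subsetI)
    obtain c where c: "c \<in> ?C" "\<forall>k\<in>?C. \<not> k \<prec> c"
      using assms(2) False unfolding wo_supp_def by (metis (mono_tags, lifting) mem_Collect_eq subsetI)
    have bc: "b \<in> II" "c \<in> II" using b c assms by (auto simp: wo_supp_def)
    have "\<forall>k\<in>A. \<not> k \<prec> b \<or> (\<forall>k\<in>A. \<not> k \<prec> c)"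
      using A_eq b c II_less_linear[OF bc] II_less_trans by blast
    moreover have "b \<in> A" "c \<in> A" using b c by auto
    ultimately show ?thesis by blast
  qed
qed

lemma wo_supp_indicator: "k \<in> II \<Longrightarrow> wo_supp (\<lambda>l. if l = k then 1 else 0)"
  by (rule wo_suppI) (auto split: if_splits simp: subset_singleton_iff II_less_irrefl)

lemma wo_supp_upd: "wo_supp f \<Longrightarrow> k \<in> II \<Longrightarrow> wo_supp (f(k := v))"
  by (erule wo_supp_Un[OF _ wo_supp_indicator]) (auto split: if_splits)

lemma first_difference:
  assumes "wo_supp f" "wo_supp g" "f \<noteq> g"
  obtains k where "k \<in> II" "f k \<noteq> g k" "agree_below k f g"
proof -
  let ?h = "\<lambda>k. f k - g k"
  have h: "wo_supp ?h" by (rule wo_supp_Un[OF assms(1,2)]) auto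
  obtain a where a: "f a \<noteq> g a" using assms(3) by blast
  obtain m where "m \<in> {k. ?h k \<noteq> 0}" "\<forall>k\<in>{k. ?h k \<noteq> 0}. \<not> k \<prec> m"
    by (rule wo_supp_min[OF h, of a "{k. ?h k \<noteq> 0}"]) (use a in auto)
  then show thesis using that[of m] h by (auto simp: agree_below_def wo_supp_def)
qed

lemma ext_less_total: "wo_supp f \<Longrightarrow> wo_supp g \<Longrightarrow> f = g \<or> ext_less f g \<or> ext_less g f"
  by (metis first_difference agree_below_sym ext_less_def less_at_def linorder_neqE)

lemma less_below_total:
  assumes "wo_supp f" "wo_supp g" "m \<in> II"
  shows "agree_below m f g \<or> less_below m f g \<or> less_below m g f"
  using ext_less_total[OF assms(1,2)]
  by (metis agree_below_def agree_below_sym assms(3) ext_less_cases)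

lemma R_lex_iff:
  assumes "J \<subseteq> II"
  shows "f \<in> R_lex J \<longleftrightarrow> wo_supp f \<and> (\<forall>k. k \<notin> J \<longrightarrow> f k = 0)"
proof (cases "\<forall>k. k \<notin> J \<longrightarrow> f k = 0")
  case True
  define A where "A = {k\<in>J. f k \<noteq> 0}"
  have A: "A = {k. f k \<noteq> 0}" "A \<subseteq> II" using True assms by (auto simp: A_def)
  define r where "r = II_ord \<inter> A \<times> A"
  have "total_on A (II_ord :: 'a set ext rel)"
    using linear_order_on_II_ord A(2) total_on_subset by (auto simp: order_on_defs)
  then have "refl_on A r" "total_on A r"
    using linear_order_on_II_ord A(2) by (auto simp: order_on_defs refl_on_def total_on_def r_def)
  moreover have "trans r" "antisym r" "r \<subseteq> A \<times> A"
    using linear_order_on_II_ord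
    by (auto simp: order_on_defs r_def intro: trans_Restr antisym_subset)
  ultimately have "linear_order_on A r" by (simp add: order_on_defs)
  moreover have r: "(k, m) \<in> r - Id \<longleftrightarrow> k \<in> A \<and> m \<in> A \<and> k \<prec> m" for k m
    by (auto simp: r_def II_less_def)
  have "wf (r - Id) \<longleftrightarrow> wo_supp f"
  proof
    assume "wf (r - Id)"
    show "wo_supp f"
    proof (rule wo_suppI)
      fix k assume "f k \<noteq> 0"
      then show "k \<in> II" using A by blast
    next
      fix B assume B: "B \<noteq> {}" "B \<subseteq> {k. f k \<noteq> 0}"
      then obtain b where b: "b \<in> B" by blast
      obtain m where m: "m \<in> B" "\<forall>k. (k, m) \<in> r - Id \<longrightarrow> k \<notin> B"
        using \<open>wf (r - Id)\<close> b unfolding wf_eq_minimal by meson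
      then have "\<not> k \<prec> m" if "k \<in> B" for k
        using that B(2) m(1) A(1) r[of k m] by blast
      then show "\<exists>m\<in>B. \<forall>k\<in>B. \<not> k \<prec> m" using m(1) by blast
    qed
  next
    assume f: "wo_supp f"
    show "wf (r - Id)"
    proof (rule wfI_min)
      fix x and B :: "'a set ext set"
      assume "x \<in> B"
      show "\<exists>z\<in>B. \<forall>y. (y, z) \<in> r - Id \<longrightarrow> y \<notin> B"
      proof (cases "x \<in> A")
        case True
        then obtain m where "m \<in> B \<inter> A" "\<forall>k\<in>B \<inter> A. \<not> k \<prec> m"
          using wo_supp_min[OF f, of x "B \<inter> A"] A(1) \<open>x \<in> B\<close> by blast
        then show ?thesis using r by blast
      qed (use \<open>x \<in> B\<close> r in blast)
    qed
  qed
  ultimately show ?thesis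
    using True by (simp add: R_lex_def hahn_product_def well_order_on_def Let_def r_def A_def)
qed (auto simp: R_lex_def hahn_product_def)

lemma R_lex_Pt_iff:
  "S \<subseteq> Prin \<Longrightarrow> f \<in> R_lex (Pt ` S) \<longleftrightarrow> wo_supp f \<and> restr f S = f"
  by (subst R_lex_iff) (auto simp: restr_def fun_eq_iff)

lemma restr_restr: "T \<subseteq> S \<Longrightarrow> restr (restr f S) T = restr f T"
  by (auto simp: restr_def fun_eq_iff)

lemma restr_supset: "restr f S = f \<Longrightarrow> S \<subseteq> T \<Longrightarrow> restr f T = f"
  unfolding restr_def fun_eq_iff by (metis image_mono subsetD)

lemma restr_upd_Gap [simp]: "restr (f(Gap T := v)) S = restr f S"
  by (auto simp: restr_def fun_eq_iff)

lemma restr_Pt: "restr f S (Pt i) = (if i \<in> S then f (Pt i) else 0)"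
  and restr_Gap: "restr f S (Gap T) = 0"
  by (auto simp: restr_def)

lemma agree_below_Gap_iff:
  assumes "S \<in> Init"
  shows "agree_below (Gap S) f g \<longleftrightarrow>
    restr f S = restr g S \<and> (\<forall>T\<in>Init. T \<subset> S \<longrightarrow> f (Gap T) = g (Gap T))" (is "?L \<longleftrightarrow> ?R")
proof
  assume ?L
  then show ?R
    using assms by (auto simp: agree_below_def restr_def fun_eq_iff Pt_less_Gap Gap_less_Gap)
next
  assume R: ?R
  then have "f (Pt i) = g (Pt i)" if "i \<in> S" for i
    using that by (metis restr_Pt)
  then show ?L
    using R by (auto simp: agree_below_def elim!: less_Gap_cases)
qed

lemma restr_eqI: "S \<in> Init \<Longrightarrow> agree_below (Gap S) f g \<Longrightarrow> restr f S = restr g S"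
  by (simp add: agree_below_Gap_iff)

section \<open>Elements of the closure\<close>

locale sme =
  fixes e :: "'a::linordered_ab_group_add dhull embs" and \<phi> :: "'a dhull hahn_emb"
  assumes Gamma_Q_R_lex: "Gamma_Q e \<phi> \<subseteq> R_lex (Pt ` Prin)"
begin

lemma Gamma_Q_wo: "x \<in> Gamma_Q e \<phi> \<Longrightarrow> wo_supp x"
  and Gamma_Q_Prin: "x \<in> Gamma_Q e \<phi> \<Longrightarrow> restr x Prin = x"
  using Gamma_Q_R_lex R_lex_Pt_iff[of Prin] by blast+

lemma comm_iff:
  "S \<in> Init \<Longrightarrow> commensurable e \<phi> S b \<longleftrightarrow> (\<exists>x\<in>Gamma_Q e \<phi>. b = restr x S)"
  unfolding commensurable_def
  by (auto simp: R_lex_Pt_iff[OF Init_sub] restr_restr wo_supp_restr Gamma_Q_wo)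

lemma incomm_iff:
  "S \<in> Init \<Longrightarrow> incommensurable e \<phi> S b \<longleftrightarrow>
     wo_supp b \<and> restr b S = b \<and> \<not> commensurable e \<phi> S b"
  by (simp add: incommensurable_def R_lex_Pt_iff[OF Init_sub])

lemma comm_wo: "S \<in> Init \<Longrightarrow> commensurable e \<phi> S b \<Longrightarrow> wo_supp b"
  and comm_restr: "S \<in> Init \<Longrightarrow> commensurable e \<phi> S b \<Longrightarrow> restr b S = b"
  by (auto simp: commensurable_def R_lex_Pt_iff[OF Init_sub])

lemma comm_mono:
  "S \<in> Init \<Longrightarrow> T \<in> Init \<Longrightarrow> T \<subseteq> S \<Longrightarrow> commensurable e \<phi> S b \<Longrightarrow> commensurable e \<phi> T (restr b T)"
  by (auto simp: comm_iff restr_restr)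

lemma Gamma_Q_Gap: "x \<in> Gamma_Q e \<phi> \<Longrightarrow> x (Gap T) = 0"
  by (metis Gamma_Q_Prin restr_Gap)

lemma EqRk_Gap: "x \<in> EqRk e \<phi> \<Longrightarrow> x (Gap T) = 0"
  unfolding EqRk_def by (auto simp: fun_eq_iff) (metis restr_Gap)

lemma comm_Gap: "S \<in> Init \<Longrightarrow> commensurable e \<phi> S b \<Longrightarrow> b (Gap T) = 0"
  by (metis comm_restr restr_Gap)

lemma sme_cases:
  assumes "x \<in> Gamma_sme e \<phi>"
  obtains "x \<in> Gamma_Q e \<phi>" | "x \<in> EqRk e \<phi>"
  | b S s where "x = b(Gap S := s)" "S \<in> Init" "commensurable e \<phi> S b" "s \<in> {1, -1}"
  using assms unfolding Gamma_sme_def Gamma_R_def IncRk_def by blast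

lemma sme_wo: "x \<in> Gamma_sme e \<phi> \<Longrightarrow> wo_supp x"
proof (erule sme_cases)
  assume "x \<in> EqRk e \<phi>"
  then show "wo_supp x" by (auto simp: EqRk_def R_lex_Pt_iff[OF subset_refl])
qed (auto simp: Gamma_Q_wo comm_wo intro!: wo_supp_upd)

lemma sme_Gap_nonzero:
  assumes "x \<in> Gamma_sme e \<phi>" "x (Gap S) \<noteq> 0"
  shows "S \<in> Init" "x = (restr x S)(Gap S := x (Gap S))" "x (Gap S) \<in> {1, -1}"
  using assms by (auto elim!: sme_cases simp: Gamma_Q_Gap EqRk_Gap comm_Gap comm_restr split: if_splits)

lemma sme_Gap_bounds:
  assumes "x \<in> Gamma_sme e \<phi>"
  shows "x (Gap S) \<le> 1" "-1 \<le> x (Gap S)"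
  using sme_Gap_nonzero(3)[OF assms, of S] by (cases "x (Gap S) = 0"; fastforce)+

lemma sme_Gap_eq:
  assumes "x \<in> Gamma_sme e \<phi>" "S \<in> Init" "agree_below (Gap S) x b" "x (Gap S) = s" "s \<noteq> 0"
    "restr b S = b"
  shows "x = b(Gap S := s)"
  using sme_Gap_nonzero(2)[OF assms(1), of S] assms restr_eqI[OF assms(2,3)] by simp

lemma IncRk_sme:
  "S \<in> Init \<Longrightarrow> commensurable e \<phi> S b \<Longrightarrow> s \<in> {1, -1} \<Longrightarrow> b(Gap S := s) \<in> Gamma_sme e \<phi>"
  unfolding Gamma_sme_def IncRk_def by blast

lemma EqRk_sme:
  assumes "S \<in> Init" "incommensurable e \<phi> S c"
    and "\<And>T. T \<in> Init \<Longrightarrow> T \<subset> S \<Longrightarrow> commensurable e \<phi> T (restr c T)"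
  shows "c \<in> Gamma_sme e \<phi>"
proof -
  have c: "wo_supp c" "restr c S = c" using assms by (auto simp: incomm_iff)
  have "restr c Prin = c"
    using restr_supset[OF c(2) Init_sub[OF assms(1)]] .
  moreover have "S \<subseteq> T" if "T \<in> Init" "incommensurable e \<phi> T (restr c T)" for T
    using that assms(1,3) Init_linear[of S T] by (auto simp: incommensurable_def)
  ultimately have "c \<in> EqRk e \<phi>"
    using assms(1,2) c unfolding EqRk_def mem_Collect_eq R_lex_Pt_iff[OF subset_refl] by metis
  then show ?thesis by (simp add: Gamma_sme_def Gamma_R_def)
qed

text \<open>An element of the closure is determined by an incommensurable restriction, since coordinates
  beyond the first incommensurable truncation vanish.\<close>

lemma sme_incomm_unique:
  assumes x: "x \<in> Gamma_sme e \<phi>" and S: "S \<in> Init" and c: "incommensurable e \<phi> S c"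
    and agree: "agree_below (Gap S) x c"
  shows "x = c"
proof -
  have cS: "restr c S = c" using S c by (simp add: incomm_iff)
  have xS: "restr x S = c" using restr_eqI[OF S agree] cS by simp
  have nc: "\<not> commensurable e \<phi> S (restr x S)"
    using c xS by (simp add: incommensurable_def)
  show ?thesis
    using x
  proof (cases rule: sme_cases)
    case 1
    then show ?thesis using nc S by (auto simp: comm_iff)
  next
    case 2
    then obtain T where "T \<in> Init" "incommensurable e \<phi> S (restr x S) \<longrightarrow> T \<subseteq> S" "x = restr x T"
      using S unfolding EqRk_def by blast
    then have "T \<subseteq> S" "x = restr x T" using c xS by auto
    then have "restr x S = x" using restr_supset by metis
    then show ?thesis using xS by simp
  next
    case (3 b T s)
    have "\<not> T \<subset> S"
    proof
      assume "T \<subset> S"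
      then have "x (Gap T) = c (Gap T)" using agree 3(2) S agree_below_Gap_iff by blast
      moreover have "c (Gap T) = 0" using cS by (metis restr_Gap)
      ultimately show False using 3 by auto
    qed
    then have "S \<subseteq> T" using Init_linear 3 S by blast
    then show ?thesis using nc comm_mono[of T S b] 3 S by simp
  qed
qed

lemma sme_linear: "linear_order_on (Gamma_sme e \<phi>) (sme_ord e \<phi>)"
  unfolding order_on_defs refl_on_def trans_def antisym_def total_on_def sme_ord_def lex_less_ext
  using ext_less_trans ext_less_asym ext_less_total sme_wo by auto blast+

end

section \<open>Suprema\<close>

locale sme_subset = sme +
  fixes X
  assumes X_sub: "X \<subseteq> Gamma_sme e \<phi>"
begin

definition ub :: "('a dhull set ext \<Rightarrow> real) \<Rightarrow> bool" where
  "ub u \<longleftrightarrow> u \<in> Gamma_sme e \<phi> \<and> (\<forall>x\<in>X. \<not> ext_less u x)"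

definition is_sup :: "('a dhull set ext \<Rightarrow> real) \<Rightarrow> bool" where
  "is_sup s \<longleftrightarrow> ub s \<and> (\<forall>u. ub u \<longrightarrow> \<not> ext_less u s)"

text \<open>\<open>good S b\<close> means that \<open>b\<close> is the maximum of \<open>X\<close> truncated below \<open>i\<^sub>S\<close>; equivalently, the cut
  defined by \<open>X\<close> lies between \<open>b\<^sup>-\<close> and \<open>b\<^sup>+\<close>.\<close>

definition good :: "'a dhull set set \<Rightarrow> ('a dhull set ext \<Rightarrow> real) \<Rightarrow> bool" where
  "good S b \<longleftrightarrow> S \<in> Init \<and> commensurable e \<phi> S b \<and>
     (\<forall>x\<in>X. \<not> less_below (Gap S) b x) \<and> (\<exists>x\<in>X. agree_below (Gap S) x b)"

lemma is_supI:
  assumes "s \<in> Gamma_sme e \<phi>" "\<And>x. x \<in> X \<Longrightarrow> \<not> ext_less s x" "\<And>u. ub u \<Longrightarrow> \<not> ext_less u s"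
  shows "is_sup s"
  using assms by (auto simp: is_sup_def ub_def)

lemma X_sme: "x \<in> X \<Longrightarrow> x \<in> Gamma_sme e \<phi>"
  using X_sub by blast

lemma ub_sme: "ub u \<Longrightarrow> u \<in> Gamma_sme e \<phi>"
  and ub_X: "ub u \<Longrightarrow> x \<in> X \<Longrightarrow> \<not> ext_less u x"
  by (auto simp: ub_def)

lemma plus_ub:
  assumes "S \<in> Init" "commensurable e \<phi> S b" and le: "\<And>x. x \<in> X \<Longrightarrow> \<not> less_below (Gap S) b x"
  shows "ub (b(Gap S := 1))"
proof -
  let ?p = "b(Gap S := 1)"
  have p: "agree_below (Gap S) ?p b"
    by (simp add: agree_below_def II_less_irrefl)
  have "\<not> ext_less ?p x" if x: "x \<in> X" for x
  proof
    assume *: "ext_less ?p x"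
    have "Gap S \<in> II" using assms by simp
    from * this show False
    proof (cases rule: ext_less_cases)
      case 1
      then have "less_below (Gap S) b x"
        using less_below_agree[OF _ p] by (simp add: agree_below_def)
      then show False using le x by blast
    next
      case 2
      then show False using sme_Gap_bounds(1)[OF X_sme[OF x], of S] by simp
    next
      case 3
      then have "x = ?p"
        using sme_Gap_eq[OF X_sme[OF x] assms(1)] comm_restr[OF assms(1,2)] p
        by (simp add: agree_below_def)
      then show False using * by (simp add: ext_less_irrefl)
    qed
  qed
  then show ?thesis using IncRk_sme assms by (simp add: ub_def)
qed

lemma minus_lower:
  assumes S: "S \<in> Init" "commensurable e \<phi> S b" and u: "u \<in> Gamma_sme e \<phi>" "\<not> less_below (Gap S) u b"
  shows "\<not> ext_less u (b(Gap S := -1))"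
proof
  let ?m = "b(Gap S := -1)"
  have m: "agree_below (Gap S) ?m b"
    by (simp add: agree_below_def II_less_irrefl)
  assume *: "ext_less u ?m"
  have "Gap S \<in> II" using assms by simp
  from * this show False
  proof (cases rule: ext_less_cases)
    case 1
    then have "less_below (Gap S) u b"
      using less_below_agree[OF _ _ m] by (simp add: agree_below_def)
    then show False using u by blast
  next
    case 2
    then show False using sme_Gap_bounds(2)[OF u(1), of S] by simp
  next
    case 3
    then have "u = ?m"
      using sme_Gap_eq[OF u(1) S(1), of b "-1"] comm_restr[OF S] m
      by (simp add: agree_below_def)
    then show False using * by (simp add: ext_less_irrefl)
  qed
qed

lemma good_ub_le:
  assumes "good S b" "ub u"
  shows "\<not> less_below (Gap S) u b"
proof
  assume *: "less_below (Gap S) u b"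
  obtain y where y: "y \<in> X" "agree_below (Gap S) y b" using assms by (auto simp: good_def)
  then have "less_below (Gap S) u y"
    using less_below_agree[OF * _ agree_below_sym] by (simp add: agree_below_def)
  then show False using ub_X[OF assms(2) y(1)] less_below_less by blast
qed

lemma good_Init: "good S b \<Longrightarrow> S \<in> Init"
  and good_comm: "good S b \<Longrightarrow> commensurable e \<phi> S b"
  by (auto simp: good_def)

lemma good_unique:
  assumes "good S b" "good S c"
  shows "b = c"
proof -
  have "\<not> less_below (Gap S) b' c'" if b': "good S b'" and c': "good S c'" for b' c'
  proof
    assume *: "less_below (Gap S) b' c'"
    obtain y where y: "y \<in> X" "agree_below (Gap S) y c'" using c' by (auto simp: good_def)
    then have "less_below (Gap S) b' y"
      using less_below_agree[OF * _ agree_below_sym] by (simp add: agree_below_def)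
    then show False using b' y by (auto simp: good_def)
  qed
  then have "agree_below (Gap S) b c"
    using less_below_total[of b c "Gap S"] assms comm_wo[OF good_Init good_comm] good_Init by auto
  then show ?thesis
    using restr_eqI[of S b c] comm_restr[OF good_Init good_comm] assms good_Init by metis
qed

lemma restr_agree_below:
  assumes "S \<in> Init" "T \<in> Init" "T \<subseteq> S" "commensurable e \<phi> S b"
  shows "agree_below (Gap T) (restr b T) b"
  using assms by (simp add: agree_below_Gap_iff restr_restr restr_Gap comm_Gap)

lemma good_restr:
  assumes "good S b" "T \<in> Init" "T \<subseteq> S"
  shows "good T (restr b T)"
proof -
  have S: "S \<in> Init" "commensurable e \<phi> S b" using assms by (auto simp: good_def)
  note r = restr_agree_below[OF S(1) assms(2,3) S(2)]
  have "\<not> less_below (Gap T) (restr b T) x" if x: "x \<in> X" for x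
  proof
    assume "less_below (Gap T) (restr b T) x"
    then have *: "less_below (Gap T) b x"
      using less_below_agree[OF _ r] by (simp add: agree_below_def)
    have "T = S \<or> Gap T \<prec> Gap S" using assms S Gap_less_Gap by blast
    then have "less_below (Gap S) b x" using * II_less_trans unfolding less_below_def by blast
    then show False using assms x by (auto simp: good_def)
  qed
  moreover obtain x where "x \<in> X" "agree_below (Gap S) x b" using assms by (auto simp: good_def)
  moreover from this have "agree_below (Gap T) x (restr b T)"
    using agree_below_Gap_mono[OF _ assms(3,2) S(1)] r agree_below_sym agree_below_trans by blast
  ultimately show ?thesis
    using comm_mono[OF S(1) assms(2,3) S(2)] assms(2) by (auto simp: good_def)
qed

text \<open>Here \<open>c\<close> is the supremum of \<open>X\<close> as far as coordinates below \<open>i\<^sub>S\<close> can tell. If it is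
  incommensurable, it lies in \<open>EqRk\<close> and is the supremum; if it is commensurable but not attained,
  the supremum is \<open>c\<^sup>-\<close>.\<close>

lemma limit:
  assumes S: "S \<in> Init" and c: "wo_supp c" "restr c S = c"
    and comm: "\<And>T. T \<in> Init \<Longrightarrow> T \<subset> S \<Longrightarrow> commensurable e \<phi> T (restr c T)"
    and X_le: "\<And>x. x \<in> X \<Longrightarrow> \<not> less_below (Gap S) c x"
    and ub_ge: "\<And>u. ub u \<Longrightarrow> \<not> less_below (Gap S) u c"
  shows "good S c \<or> (\<exists>s. is_sup s)"
proof (cases "commensurable e \<phi> S c")
  case False
  then have inc: "incommensurable e \<phi> S c" using S c by (simp add: incomm_iff)
  have eq: "x = c" if "x \<in> Gamma_sme e \<phi>" "agree_below (Gap S) x c" for x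
    using sme_incomm_unique[OF _ S inc] that by blast
  have "Gap S \<in> II" using S by simp
  have "is_sup c"
  proof (rule is_supI)
    show "c \<in> Gamma_sme e \<phi>" using EqRk_sme[OF S inc] comm by blast
    show "\<not> ext_less c x" if "x \<in> X" for x
      using ext_less_cases[OF _ \<open>Gap S \<in> II\<close>] X_le that eq[OF X_sme agree_below_sym] ext_less_irrefl
      by metis
    show "\<not> ext_less u c" if "ub u" for u
      using ext_less_cases[OF _ \<open>Gap S \<in> II\<close>] ub_ge that eq[OF ub_sme] ext_less_irrefl
      by metis
  qed
  then show ?thesis by blast
next
  case True
  show ?thesis
  proof (cases "\<exists>x\<in>X. agree_below (Gap S) x c")
    case True
    then show ?thesis using X_le S \<open>commensurable e \<phi> S c\<close> by (auto simp: good_def)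
  next
    case False
    let ?m = "c(Gap S := -1)"
    have "Gap S \<in> II" using S by simp
    have m: "agree_below (Gap S) c ?m" by (simp add: agree_below_def II_less_irrefl)
    have "is_sup ?m"
    proof (rule is_supI)
      show "?m \<in> Gamma_sme e \<phi>" using IncRk_sme[OF S True] by simp
    next
      fix x assume x: "x \<in> X"
      then have "less_below (Gap S) x c"
        using less_below_total[OF c(1) sme_wo[OF X_sme[OF x]] \<open>Gap S \<in> II\<close>] False X_le agree_below_sym
        by blast
      then have "less_below (Gap S) x ?m"
        using less_below_agree[OF _ _ m] by (simp add: agree_below_def)
      then show "\<not> ext_less ?m x" using less_below_asym by blast
    next
      show "\<not> ext_less u ?m" if "ub u" for u
        using minus_lower[OF S True ub_sme ub_ge] that by blast
    qed
    then show ?thesis by blast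
  qed
qed

definition good_union :: "'a dhull set set" where
  "good_union = \<Union> {S. \<exists>b. good S b}"

definition glue :: "'a dhull set ext \<Rightarrow> real" where
  "glue k = (if \<exists>S b. good S b \<and> k \<in> Pt ` S then (THE v. \<exists>S b. good S b \<and> k \<in> Pt ` S \<and> v = b k) else 0)"

lemma good_union_Init: "good_union \<in> Init"
  unfolding good_union_def by (rule Init_Union) (auto simp: good_def)

lemma glue_eq:
  assumes "good S b" "i \<in> S"
  shows "glue (Pt i) = b (Pt i)"
proof -
  have "c (Pt i) = b (Pt i)" if T: "good T c" "i \<in> T" for T c
  proof -
    consider "T \<subseteq> S" | "S \<subseteq> T" using Init_linear[OF good_Init[OF T(1)] good_Init[OF assms(1)]] by blast
    then show ?thesis
    proof cases
      case 1
      then have "c = restr b T"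
        using good_unique[OF T(1) good_restr[OF assms(1) good_Init[OF T(1)]]] by blast
      then show ?thesis using T by (simp add: restr_Pt)
    next
      case 2
      then have "b = restr c S"
        using good_unique[OF assms(1) good_restr[OF T(1) good_Init[OF assms(1)]]] by blast
      then show ?thesis using assms by (simp add: restr_Pt)
    qed
  qed
  then have "(THE v. \<exists>T c. good T c \<and> Pt i \<in> Pt ` T \<and> v = c (Pt i)) = b (Pt i)"
    using assms by (intro the_equality) blast+
  moreover have "\<exists>T c. good T c \<and> Pt i \<in> Pt ` T" using assms by blast
  ultimately show ?thesis by (simp add: glue_def)
qed

lemma glue_restr:
  assumes "good S b"
  shows "restr glue S = b"
proof -
  have "restr glue S = restr b S"
    using glue_eq[OF assms] by (auto simp: restr_def fun_eq_iff)
  then show ?thesis using comm_restr good_Init good_comm assms by metis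
qed

lemma good_glue:
  assumes "i \<in> good_union"
  obtains S where "i \<in> S" "good S (restr glue S)"
  using assms glue_restr unfolding good_union_def by blast

lemma good_subset: "good S b \<Longrightarrow> S \<subseteq> good_union"
  by (auto simp: good_union_def)

lemma restr_glue: "restr glue good_union = glue"
proof
  fix k
  show "restr glue good_union k = glue k"
    by (cases "k \<in> Pt ` good_union") (auto simp: restr_def glue_def good_union_def)
qed

lemma glue_Gap: "glue (Gap T) = 0"
  by (metis restr_glue restr_Gap)

lemma glue_nonzero: "glue k \<noteq> 0 \<Longrightarrow> k \<in> Pt ` good_union"
  by (metis restr_glue restr_def)

lemma glue_wo: "wo_supp glue"
proof (rule wo_suppI)
  show "k \<in> II" if "glue k \<noteq> 0" for k
    using glue_nonzero[OF that] Init_sub[OF good_union_Init] by auto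
next
  fix A assume A: "A \<noteq> {}" "A \<subseteq> {k. glue k \<noteq> 0}"
  then obtain a where "a \<in> A" "glue a \<noteq> 0" by blast
  then obtain i where i: "i \<in> good_union" "a = Pt i" using glue_nonzero by blast
  obtain S where S: "i \<in> S" "good S (restr glue S)" by (rule good_glue[OF i(1)])
  have wo: "wo_supp (restr glue S)" by (rule comm_wo[OF good_Init[OF S(2)] good_comm[OF S(2)]])
  have sub: "A \<inter> Pt ` S \<subseteq> {k. restr glue S k \<noteq> 0}" using A by (auto simp: restr_def)
  have a: "a \<in> A \<inter> Pt ` S" using S i \<open>a \<in> A\<close> by blast
  obtain m where m: "m \<in> A \<inter> Pt ` S" "\<forall>k\<in>A \<inter> Pt ` S. \<not> k \<prec> m"
    by (rule wo_supp_min[OF wo a sub])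
  have "\<not> k \<prec> m" if "k \<in> A" for k
  proof
    assume *: "k \<prec> m"
    have "glue k \<noteq> 0" using that A by blast
    then obtain j where "k = Pt j" using glue_nonzero[of k] by blast
    moreover obtain l where "m = Pt l" "l \<in> S" using m by blast
    ultimately have "k \<in> Pt ` S" using * Init_closed[OF good_Init[OF S(2)]] by (auto simp: Pt_less_Pt)
    then show False using m that * by blast
  qed
  then show "\<exists>m\<in>A. \<forall>k\<in>A. \<not> k \<prec> m" using m by blast
qed

lemma below_good:
  assumes "k \<prec> Gap good_union" "\<not> good good_union glue"
  obtains T where "good T (restr glue T)" "k \<prec> Gap T"
proof -
  have "\<exists>i\<in>good_union. k = Pt i \<or> k \<prec> Pt i"
    using assms(1)
  proof (cases rule: less_Gap_cases)
    case (2 T)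
    then obtain i where "i \<in> good_union" "i \<notin> T" by blast
    then show ?thesis using 2 Gap_less_Pt[OF 2(2)] Init_sub[OF good_union_Init] by blast
  qed blast
  then obtain i where i: "i \<in> good_union" "k = Pt i \<or> k \<prec> Pt i" by blast
  obtain T where T: "i \<in> T" "good T (restr glue T)" by (rule good_glue[OF i(1)])
  then have "Pt i \<prec> Gap T" using Pt_less_Gap good_Init by blast
  then show thesis using that T i II_less_trans by blast
qed

lemma glue_comm:
  assumes "T \<in> Init" "T \<subset> good_union"
  shows "commensurable e \<phi> T (restr glue T)"
proof -
  obtain i where i: "i \<in> good_union" "i \<notin> T" using assms by blast
  obtain S where S: "i \<in> S" "good S (restr glue S)" by (rule good_glue[OF i(1)])
  then have "T \<subset> S" using Init_subset_iff[of S T i] good_Init assms i by blast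
  then show ?thesis
    using comm_mono[OF good_Init assms(1) _ good_comm, OF S(2) _ S(2)] restr_restr[of T S glue] by simp
qed

lemma sup_if_not_good:
  assumes "\<not> good good_union glue"
  shows "\<exists>s. is_sup s"
proof -
  have agree: "agree_below (Gap T) glue (restr glue T)" if "good T b" for T b
    using good_Init[OF that] by (simp add: agree_below_Gap_iff restr_restr glue_Gap restr_Gap)
  have "\<not> less_below (Gap good_union) glue x" if "x \<in> X" for x
  proof
    assume "less_below (Gap good_union) glue x"
    then obtain k where k: "k \<prec> Gap good_union" "less_at k glue x" by (auto simp: less_below_def)
    obtain T where T: "good T (restr glue T)" "k \<prec> Gap T" by (rule below_good[OF k(1) assms])
    then have "less_below (Gap T) glue x" using k by (auto simp: less_below_def)
    then have "less_below (Gap T) (restr glue T) x"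
      using less_below_agree[OF _ agree[OF T(1)]] by (simp add: agree_below_def)
    then show False using T that by (auto simp: good_def)
  qed
  moreover have "\<not> less_below (Gap good_union) u glue" if "ub u" for u
  proof
    assume "less_below (Gap good_union) u glue"
    then obtain k where k: "k \<prec> Gap good_union" "less_at k u glue" by (auto simp: less_below_def)
    obtain T where T: "good T (restr glue T)" "k \<prec> Gap T" by (rule below_good[OF k(1) assms])
    then have "less_below (Gap T) u glue" using k by (auto simp: less_below_def)
    then have "less_below (Gap T) u (restr glue T)"
      using less_below_agree[OF _ _ agree[OF T(1)]] by (simp add: agree_below_def)
    then show False using good_ub_le[OF T(1) that] by blast
  qed
  ultimately show ?thesis
    using limit[OF good_union_Init glue_wo restr_glue glue_comm] assms by blast
qed

lemma sup_if_good:
  assumes good: "good good_union glue"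
  shows "\<exists>s. is_sup s"
proof (rule ccontr)
  assume no_sup: "\<nexists>s. is_sup s"
  let ?S = good_union
  let ?p = "glue(Gap ?S := 1)" and ?m = "glue(Gap ?S := -1)"
  note Init = good_union_Init and comm = good_comm[OF good]
  have Gap: "Gap ?S \<in> II" using Init by simp
  have p: "agree_below (Gap ?S) ?p glue" and m: "agree_below (Gap ?S) ?m glue"
    by (simp_all add: agree_below_def II_less_irrefl)
  define F where "F z \<longleftrightarrow> z \<in> Gamma_sme e \<phi> \<and> agree_below (Gap ?S) z glue \<and> z (Gap ?S) = 0" for z
  have between: "F z" if z: "z \<in> Gamma_sme e \<phi>" "ext_less ?m z" "ext_less z ?p" for z
  proof -
    have 1: "\<not> less_below (Gap ?S) z glue"
      using less_below_asym[OF less_below_agree[OF _ _ agree_below_sym[OF m]]] z(2)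
      by (auto simp: agree_below_def)
    have 2: "\<not> less_below (Gap ?S) glue z"
      using less_below_asym[OF less_below_agree[OF _ agree_below_sym[OF p]]] z(3)
      by (auto simp: agree_below_def)
    have agree: "agree_below (Gap ?S) z glue"
      using less_below_total[OF sme_wo[OF z(1)] glue_wo Gap] 1 2 by blast
    moreover have "z (Gap ?S) = 0"
    proof (rule ccontr)
      assume nz: "z (Gap ?S) \<noteq> 0"
      then have "z (Gap ?S) \<in> {1, -1}" using sme_Gap_nonzero(3)[OF z(1)] by blast
      then have "z = ?p \<or> z = ?m"
        using sme_Gap_eq[OF z(1) Init agree _ _ restr_glue] by auto
      then show False using z ext_less_irrefl by blast
    qed
    ultimately show ?thesis using z by (simp add: F_def)
  qed
  have ub_p: "ub ?p" using plus_ub[OF Init comm] good by (auto simp: good_def)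
  then obtain u where u: "ub u" "ext_less u ?p" using no_sup unfolding is_sup_def by blast
  have m_le: "\<not> ext_less v ?m" if "ub v" for v
    using minus_lower[OF Init comm ub_sme[OF that] good_ub_le[OF good that]] .
  then have "\<not> ub ?m" using no_sup unfolding is_sup_def by blast
  moreover have "?m \<in> Gamma_sme e \<phi>" using IncRk_sme[OF Init comm] by simp
  ultimately obtain x where x: "x \<in> X" "ext_less ?m x" unfolding ub_def by blast
  have X_less_p: "ext_less z ?p" if "z \<in> X" for z
    using ext_less_total[OF sme_wo[OF X_sme[OF that]] sme_wo[OF ub_sme[OF ub_p]]]
      ub_X[OF ub_p that] ub_X[OF u(1) that] u(2) by blast
  have F_X: "F z" if "z \<in> X" "ext_less ?m z" for z
    using between X_sme X_less_p that by blast
  have F_ub: "F v" if "ub v" "ext_less v ?p" for v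
  proof -
    have "v \<noteq> ?m" using \<open>\<not> ub ?m\<close> that by blast
    then show ?thesis
      using between[OF ub_sme[OF that(1)] _ that(2)] m_le[OF that(1)]
        ext_less_total[OF sme_wo[OF ub_sme[OF that(1)]] sme_wo[OF \<open>?m \<in> _\<close>]] by blast
  qed
  have Fx: "F x" and Fu: "F u" using F_X x F_ub u by blast+
  have Prin: "Prin \<in> Init" by (auto simp: Init_def Prin_ord_def)
  show False
  proof (cases "?S = Prin")
    case True
    have "x = u"
    proof (rule ccontr)
      assume "x \<noteq> u"
      then obtain k where k: "k \<in> II" "x k \<noteq> u k"
        using first_difference Fx Fu sme_wo unfolding F_def by metis
      then have "k \<prec> Gap ?S \<or> k = Gap ?S"
        using True Init_sub by (cases k) (auto simp: Pt_less_Gap[OF Prin] Gap_less_Gap[OF Prin])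
      then show False using Fx Fu k by (auto simp: F_def agree_below_def)
    qed
    then have "is_sup u" using u x ub_X by (auto simp: is_sup_def)
    then show False using no_sup by blast
  next
    case False
    show False
    proof (cases "\<exists>j\<in>Prin - ?S. \<forall>i\<in>Prin - ?S. (j, i) \<in> Prin_ord")
      case True
      then obtain j where j: "j \<in> Prin" "j \<notin> ?S" and min: "\<And>i. i \<in> Prin - ?S \<Longrightarrow> (j, i) \<in> Prin_ord"
        by blast
      let ?S' = "insert j ?S"
      have Init': "?S' \<in> Init"
        unfolding Init_def mem_Collect_eq
      proof (intro conjI ballI allI impI)
        show "?S' \<subseteq> Prin" using j Init_sub[OF Init] by blast
        fix i l assume i: "i \<in> ?S'" and l: "(l, i) \<in> Prin_ord"
        show "l \<in> ?S'"
        proof (cases "l \<in> ?S")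
          case False
          then have "i = j" using i Init_closed[OF Init _ l] by blast
          moreover have "(j, l) \<in> Prin_ord" using min l False by (auto simp: Prin_ord_def)
          ultimately show ?thesis using l by (auto simp: Prin_ord_def)
        qed blast
      qed
      have below: "k \<prec> Gap ?S \<or> k = Gap ?S \<or> k = Pt j" if "k \<prec> Gap ?S'" for k
        using that
      proof (cases rule: less_Gap_cases)
        case (1 i)
        then show ?thesis using Pt_less_Gap[OF Init] by blast
      next
        case (2 T)
        then have "T \<subseteq> ?S" using Init_linear[OF _ Init, of T] j by blast
        then show ?thesis using 2 Gap_less_Gap[OF Init, of T] by blast
      qed
      have Pt_j: "Pt j \<prec> Gap ?S'" "Gap ?S \<prec> Pt j" "\<not> Pt j \<prec> Gap ?S"
        using Pt_less_Gap[OF Init'] Pt_less_Gap[OF Init] Gap_less_Pt[OF Init] j by auto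
      have agree_j: "agree_below (Pt j) f g"
        if "agree_below (Gap ?S) f g" "f (Gap ?S) = g (Gap ?S)" for f g
        unfolding agree_below_def
      proof (intro allI impI)
        fix k assume k: "k \<prec> Pt j"
        then have "k \<noteq> Pt j" using II_less_irrefl by blast
        then have "k \<prec> Gap ?S \<or> k = Gap ?S" using below[OF II_less_trans[OF k Pt_j(1)]] by blast
        then show "f k = g k" using that by (auto simp: agree_below_def)
      qed
      have F_agree: "agree_below (Pt j) f g" if "F f" "F g" for f g
        using that agree_j[OF agree_below_trans[of _ f glue g, OF _ agree_below_sym]] by (simp add: F_def)
      have less_j: "less_at (Pt j) f g" if "F f" "F g" "f (Pt j) < g (Pt j)" for f g
        using F_agree that j by (simp add: less_at_def)
      let ?R = "(\<lambda>z. z (Pt j)) ` {z\<in>X. F z}"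
      have le_ub: "z (Pt j) \<le> v (Pt j)" if "z \<in> X" "F z" "ub v" "F v" for z v
        using less_j ub_X that unfolding ext_less_def by (meson not_le)
      define r where "r = Sup ?R"
      have R: "?R \<noteq> {}" "bdd_above ?R"
        using x Fx le_ub[OF _ _ u(1) Fu] by (auto intro!: bdd_aboveI2[of _ _ "u (Pt j)"])
      let ?c = "glue(Pt j := r)"
      have c_glue: "agree_below (Gap ?S) ?c glue" using Pt_j by (auto simp: agree_below_def)
      have c_Gap: "?c (Gap ?S) = 0" by (simp add: glue_Gap)
      have c_agree: "agree_below (Pt j) ?c f" if "F f" for f
        using that agree_j[OF agree_below_trans[OF c_glue agree_below_sym]] c_Gap by (simp add: F_def)
      have c_wo: "wo_supp ?c" using wo_supp_upd[OF glue_wo] j by simp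
      have c_restr: "restr ?c ?S' = ?c"
        using glue_nonzero by (fastforce simp: restr_def fun_eq_iff)
      have c_comm: "commensurable e \<phi> T (restr ?c T)" if "T \<in> Init" "T \<subset> ?S'" for T
      proof -
        have "T \<subseteq> ?S" using Init_linear[OF that(1) Init] that j by blast
        moreover from this have "restr ?c T = restr glue T" using j by (auto simp: restr_def fun_eq_iff)
        ultimately show ?thesis using comm_mono[OF Init that(1) _ comm] by simp
      qed
      have X_le: "\<not> less_below (Gap ?S') ?c z" if z: "z \<in> X" for z
      proof
        assume *: "less_below (Gap ?S') ?c z"
        have "\<not> less_below (Gap ?S) ?c z"
          using less_below_agree[OF _ c_glue, of z z] good z by (auto simp: good_def agree_below_def)
        with * obtain k where k: "less_at k ?c z" "k = Gap ?S \<or> k = Pt j"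
          unfolding less_below_def using below by blast
        have "less_at (Gap ?S) ?m z \<or> less_at (Gap ?S) ?m ?c \<and> less_at k ?c z"
          using k(1) c_Gap Gap agree_below_trans[OF m agree_below_sym[OF c_glue]]
          by (simp add: less_at_def)
        then have "ext_less ?m z" using less_at_trans unfolding ext_less_def by blast
        then have Fz: "F z" using F_X z by blast
        then have "k = Pt j" using k c_Gap by (auto simp: F_def less_at_def)
        then have "r < z (Pt j)" using k by (simp add: less_at_def)
        then show False using cSup_upper[OF _ R(2), of "z (Pt j)"] z Fz by (auto simp: r_def)
      qed
      have ub_ge: "\<not> less_below (Gap ?S') v ?c" if v: "ub v" for v
      proof
        assume *: "less_below (Gap ?S') v ?c"
        have "\<not> less_below (Gap ?S) v ?c"
          using less_below_agree[OF _ _ c_glue, of v v] good_ub_le[OF good v] by (auto simp: agree_below_def)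
        with * obtain k where k: "less_at k v ?c" "k = Gap ?S \<or> k = Pt j"
          unfolding less_below_def using below by blast
        have "less_at (Gap ?S) ?c ?p"
          using c_Gap Gap agree_below_trans[OF c_glue agree_below_sym[OF p]] by (simp add: less_at_def)
        then have "ext_less v ?p" using k(1) less_at_trans by blast
        then have Fv: "F v" using F_ub v by blast
        then have "k = Pt j" using k c_Gap by (auto simp: F_def less_at_def)
        then have "v (Pt j) < r" using k by (simp add: less_at_def)
        then obtain z where "z \<in> X" "F z" "v (Pt j) < z (Pt j)"
          using less_cSup_iff[OF R] by (auto simp: r_def)
        then show False using le_ub v Fv by fastforce
      qed
      have "good ?S' ?c"
        using limit[OF Init' c_wo c_restr c_comm X_le ub_ge] no_sup by blast
      then show False using good_subset j by blast
    next
      case no_min: False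
      obtain b where b: "b \<in> Gamma_Q e \<phi>" "glue = restr b ?S" using comm comm_iff[OF Init] by blast
      let ?D = "\<lambda>j. {i. (i, j) \<in> Prin_ord}"
      have bS: "agree_below (Gap ?S) glue b"
        using Init b by (simp add: agree_below_Gap_iff restr_restr restr_Gap Gamma_Q_Gap)
      have ex: "\<exists>j\<in>Prin - ?S. agree_below (Gap (?D j)) z b" if "F z" for z
      proof (cases "z = b")
        case True
        then show ?thesis using False Init_sub[OF Init] by (auto simp: agree_below_def)
      next
        case False
        have z: "z \<in> Gamma_sme e \<phi>" "agree_below (Gap ?S) z b" "z (Gap ?S) = b (Gap ?S)"
          using that agree_below_trans[OF _ bS] b by (auto simp: F_def Gamma_Q_Gap)
        obtain l where l: "l \<in> II" "z l \<noteq> b l" "agree_below l z b"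
          using first_difference[OF sme_wo[OF z(1)] Gamma_Q_wo[OF b(1)] False] by blast
        have "Gap ?S \<prec> l" using II_less_linear[OF Gap l(1)] z l by (auto simp: agree_below_def)
        have "\<exists>j\<in>Prin - ?S. Pt j \<prec> l"
        proof (cases l)
          case (Pt i)
          then have i: "i \<in> Prin - ?S" using \<open>Gap ?S \<prec> l\<close> Gap_less_Pt[OF Init] by blast
          then obtain j where "j \<in> Prin - ?S" "(i, j) \<notin> Prin_ord" using no_min by blast
          then show ?thesis using i Prin_linear[of i j] Pt by (auto simp: Pt_less_Pt)
        next
          case (Gap T)
          then have T: "T \<in> Init" "?S \<subset> T" using \<open>Gap ?S \<prec> l\<close> l Gap_less_Gap[OF _ Init] by auto
          then obtain j where "j \<in> T" "j \<notin> ?S" by blast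
          then show ?thesis using T Gap Pt_less_Gap Init_sub by blast
        qed
        then obtain j where j: "j \<in> Prin - ?S" "Pt j \<prec> l" by blast
        have "k = Pt j \<or> k \<prec> Pt j" if "k \<prec> Gap (?D j)" for k
          using that
        proof (cases rule: less_Gap_cases)
          case (2 T)
          then have "j \<notin> T" using Init_closed by blast
          then show ?thesis using 2 j Gap_less_Pt by blast
        qed (auto simp: Pt_less_Pt)
        then have "agree_below (Gap (?D j)) z b"
          using l(3) j(2) II_less_trans unfolding agree_below_def by blast
        then show ?thesis using j by blast
      qed
      obtain j where j: "j \<in> Prin - ?S" and agree: "agree_below (Gap (?D j)) x b" "agree_below (Gap (?D j)) u b"
      proof -
        obtain jx where jx: "jx \<in> Prin - ?S" "agree_below (Gap (?D jx)) x b" using ex[OF Fx] by blast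
        obtain ju where ju: "ju \<in> Prin - ?S" "agree_below (Gap (?D ju)) u b" using ex[OF Fu] by blast
        have mono: "agree_below (Gap (?D i)) f b" if "agree_below (Gap (?D j)) f b" "?D i \<subseteq> ?D j" for i j f
          using agree_below_Gap_mono[OF that] Init_below by blast
        consider "?D jx \<subseteq> ?D ju" | "?D ju \<subseteq> ?D jx"
          using Init_linear[OF Init_below Init_below] by blast
        then show thesis using that jx ju mono by cases blast+
      qed
      let ?c = "restr b (?D j)"
      have c: "agree_below (Gap (?D j)) ?c b"
        using b by (simp add: agree_below_Gap_iff Init_below restr_restr restr_Gap Gamma_Q_Gap)
      have "\<not> less_below (Gap (?D j)) ?c z" if "z \<in> X" for z
      proof
        assume "less_below (Gap (?D j)) ?c z"
        then have "less_below (Gap (?D j)) u z"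
          using less_below_agree[OF _ agree_below_trans[OF c agree_below_sym[OF agree(2)]]]
          by (simp add: agree_below_def)
        then show False using less_below_less ub_X[OF u(1) that] by blast
      qed
      moreover have "agree_below (Gap (?D j)) x ?c"
        using agree(1) c agree_below_sym agree_below_trans by blast
      ultimately have "good (?D j) ?c"
        using b x Init_below by (auto simp: good_def comm_iff)
      then have "?D j \<subseteq> ?S" by (rule good_subset)
      moreover have "j \<in> ?D j" using j by (simp add: Prin_ord_def)
      ultimately show False using j by blast
    qed
  qed
qed

lemma sup_exists: "\<exists>s. is_sup s"
  using sup_if_good sup_if_not_good by blast

end

section \<open>The divisible hull inside the Hahn product\<close>

lemma Q_embedding_zero:
  assumes "i \<in> Prin" "Q_embedding i f"
  shows "f (H_star i) = 0"
proof -
  let ?H = "H_star i"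
  have H: "convex_subgroup ?H" "?H \<subset> i" using H_star_greatest[OF assms(1)] by blast+
  have "x + y \<in> ?H" if "x \<in> ?H" "y \<in> ?H" for x y
  proof -
    have "0 - y \<in> ?H" using H that unfolding convex_subgroup_def by blast
    then have "x - (0 - y) \<in> ?H" using H that unfolding convex_subgroup_def by blast
    then show ?thesis by simp
  qed
  moreover have zero: "0 \<in> ?H" using H unfolding convex_subgroup_def by blast
  ultimately have "?H + ?H = ?H" by (force simp: set_plus_def)
  moreover have "?H \<in> Q i" unfolding Q_def using zero H by (force simp: elt_set_plus_def)
  ultimately show ?thesis using assms(2) unfolding Q_embedding_def by force
qed

lemma realize_R_lex:
  assumes "\<And>i. i \<in> Prin \<Longrightarrow> Q_embedding i (e i)" and "immediate_embedding \<phi>"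
  shows "realize e \<phi> x \<in> R_lex (Pt ` Prin)"
proof -
  let ?f = "realize e \<phi> x"
  define B where "B = {i\<in>Prin. \<phi> x i \<noteq> H_star i}"
  have supp: "k \<in> Pt ` B" if "?f k \<noteq> 0" for k
    using that Q_embedding_zero[OF _ assms(1)]
    by (auto simp: realize_def B_def split: ext.splits if_splits)
  have "\<phi> x \<in> hahn_product Prin Prin_ord Q H_star"
    using assms(2) by (simp add: immediate_embedding_def)
  then have "wf (Prin_ord \<inter> B \<times> B - Id)"
    by (simp add: hahn_product_def well_order_on_def Let_def B_def)
  then have min: "\<exists>m\<in>C. \<forall>k. (k, m) \<in> Prin_ord \<inter> B \<times> B - Id \<longrightarrow> k \<notin> C" if "c \<in> C" for c C
    using that unfolding wf_eq_minimal by meson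
  have "wo_supp ?f"
  proof (rule wo_suppI)
    show "k \<in> II" if "?f k \<noteq> 0" for k using supp[OF that] by (auto simp: B_def)
  next
    fix A assume A: "A \<noteq> {}" "A \<subseteq> {k. ?f k \<noteq> 0}"
    then have AB: "A \<subseteq> Pt ` B" using supp by blast
    then obtain c where "c \<in> {i. Pt i \<in> A}" using A(1) by blast
    from min[OF this] obtain m where
      m: "Pt m \<in> A" "\<forall>k. (k, m) \<in> Prin_ord \<inter> B \<times> B - Id \<longrightarrow> Pt k \<notin> A" by blast
    have "\<not> k \<prec> Pt m" if k: "k \<in> A" for k
    proof
      assume "k \<prec> Pt m"
      moreover obtain i where "k = Pt i" "i \<in> B" using AB k by blast
      moreover have "m \<in> B" using AB m by blast
      ultimately have "(i, m) \<in> Prin_ord \<inter> B \<times> B - Id" by (simp add: Pt_less_Pt)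
      then show False using m k \<open>k = Pt i\<close> by blast
    qed
    then show "\<exists>m\<in>A. \<forall>k\<in>A. \<not> k \<prec> m" using m(1) by blast
  qed
  moreover have "?f k = 0" if "k \<notin> Pt ` Prin" for k
    using supp[of k] that by (auto simp: B_def)
  ultimately show ?thesis by (subst R_lex_iff) auto
qed

theorem theorem3p7:
  fixes e :: "'a::linordered_ab_group_add dhull set \<Rightarrow> 'a dhull set \<Rightarrow> real"
    and \<phi> :: "'a dhull \<Rightarrow> 'a dhull set \<Rightarrow> 'a dhull set"
  assumes "\<And>i. i \<in> Prin \<Longrightarrow> Q_embedding i (e i)"
    and "immediate_embedding \<phi>"
  shows "linear_order_on (Gamma_sme e \<phi>) (sme_ord e \<phi>) \<and>
    (\<forall>X. X \<subseteq> Gamma_sme e \<phi> \<and> X \<noteq> {} \<longrightarrow>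
      (\<exists>s\<in>Gamma_sme e \<phi>. (\<forall>x\<in>X. (x, s) \<in> sme_ord e \<phi>) \<and>
        (\<forall>u\<in>Gamma_sme e \<phi>. (\<forall>x\<in>X. (x, u) \<in> sme_ord e \<phi>) \<longrightarrow> (s, u) \<in> sme_ord e \<phi>)))"
proof -
  interpret sme e \<phi>
    by unfold_locales (auto simp: Gamma_Q_def intro: realize_R_lex assms)
  have le: "(x, y) \<in> sme_ord e \<phi> \<longleftrightarrow> \<not> ext_less y x"
    if "x \<in> Gamma_sme e \<phi>" "y \<in> Gamma_sme e \<phi>" for x y
    using that ext_less_total[OF sme_wo sme_wo, of x y] ext_less_asym ext_less_irrefl
    unfolding sme_ord_def lex_less_ext by auto
  have "\<exists>s\<in>Gamma_sme e \<phi>. (\<forall>x\<in>X. (x, s) \<in> sme_ord e \<phi>) \<and>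
      (\<forall>u\<in>Gamma_sme e \<phi>. (\<forall>x\<in>X. (x, u) \<in> sme_ord e \<phi>) \<longrightarrow> (s, u) \<in> sme_ord e \<phi>)"
    if X: "X \<subseteq> Gamma_sme e \<phi>" "X \<noteq> {}" for X
  proof -
    interpret sme_subset e \<phi> X by unfold_locales (rule X(1))
    obtain s where s: "is_sup s" using sup_exists by blast
    then have mem: "s \<in> Gamma_sme e \<phi>" by (simp add: is_sup_def ub_def)
    have "(x, s) \<in> sme_ord e \<phi>" if "x \<in> X" for x
      using s that le[OF X_sme mem] by (simp add: is_sup_def ub_def)
    moreover have "(s, u) \<in> sme_ord e \<phi>"
      if "u \<in> Gamma_sme e \<phi>" "\<forall>x\<in>X. (x, u) \<in> sme_ord e \<phi>" for u
      using s that le[OF mem] le[OF X_sme] by (simp add: is_sup_def ub_def)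
    ultimately show ?thesis using mem by blast
  qed
  then show ?thesis using sme_linear by blast
qed

end
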